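(* Let $T$ be a rooted tree as in the context. The set of irregular points for the Dirichlet problem has capacity zero, that is, $$c\Big(\Big\{\zeta\in\partial T:\ \text{there exists }\varphi\in C(\partial T)\text{ such that it is not the case that }\lim_{x\to\zeta}\mathcal{P}(\varphi)(x)=\varphi(\zeta)\Big\}\Big)=0,$$ where $c=c_2$ is the $2$-capacity, $\mathcal P(\varphi)$ is the Poisson integral of $\varphi$, and the limit is the radial limit along the geodesic $\zeta$.
   Context: Tree: $T$ is a locally finite tree (connected graph without cycles, every vertex having finitely many neighbours) with vertex set $V(T)$, edge set $E(T)$ and a distinguished root edge $\omega$. One endpoint $o=b(\omega)$ of $\omega$ is an endpoint of no other edge, and every vertex other than $o$ is an endpoint of at least two edges (no leaves). The boundary $\partial T$ is the set of infinite geodesics (infinite edge paths without backtracking) starting with $\omega$; $\partial T_\alpha$ is the set of those passing through the edge $\alpha$, and the sets $\partial T_\alpha$, $\alpha\in E(T)$, form a basis of the topology of $\partial T$; $T\cup\partial T$ is a compactification of $T$. For $\zeta\in\partial T$, $\alpha<\zeta$ means that the edge $\alpha$ belongs to $\zeta$. If $x_0=o,x_1,x_2,\dots$ are the successive vertices of $\zeta$, the radial limit is $\lim_{x\to\zeta}g(x):=\lim_{j\to\infty}g(x_j)$. Capacity: for $f:E(T)\to[0,\infty)$ let $If(\zeta)=\sum_{\alpha<\zeta}f(\alpha)$. For Borel $E\subseteq\partial T$, $c(E)=c_2(E)=\inf\{\sum_{\alpha\in E(T)} f(\alpha)^2:\ f:E(T)\to[0,\infty),\ If\ge1\text{ on }E\}$.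 Poisson integral: let $(Z_n)$ be the simple random walk on $V(T)$ (uniform choice among neighbours) stopped when it hits $o$, and let $\mathbb{P}_x$ be its law started at $x$. There is a random variable $Z_\infty$ with values in $\partial T\cup\{o\}$ such that $Z_n\to Z_\infty$ $\mathbb{P}_x$-almost surely for every $x$. For Borel $E\subseteq\partial T\cup\{o\}$ put $\lambda_x(E)=\mathbb{P}_x(Z_\infty\in E)$, and for $\varphi\in C(\partial T)$ (continuous, real-valued) put $\mathcal{P}(\varphi)(x)=\int_{\partial T}\varphi\,d\lambda_x$, $x\in V(T)$. *)

theory Defs
  imports "HOL-Probability.Probability"
begin

section \<open>Rooted trees\<close>

text \<open>Edges are two-element sets of vertices. A cycle is given by the list of its distinct
  vertices, of which there are at least three.\<close>

definition graph_cycle :: "'v set set \<Rightarrow> 'v list \<Rightarrow> bool" where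
  "graph_cycle E p \<longleftrightarrow>
     3 \<le> length p \<and> distinct p \<and> successively (\<lambda>x y. {x, y} \<in> E) p \<and> {last p, hd p} \<in> E"

definition graph_connected :: "'v set \<Rightarrow> 'v set set \<Rightarrow> bool" where
  "graph_connected V E \<longleftrightarrow>
     (\<forall>x\<in>V. \<forall>y\<in>V. \<exists>p. p \<noteq> [] \<and> hd p = x \<and> last p = y \<and> successively (\<lambda>u v. {u, v} \<in> E) p)"

definition neighbours :: "'v set set \<Rightarrow> 'v \<Rightarrow> 'v set" where
  "neighbours E x = {y. {x, y} \<in> E}"

locale rooted_tree =
  fixes V :: "'v set" and E :: "'v set set" and \<omega> :: "'v set" and r :: 'v
  assumes edges: "E \<subseteq> {{x, y} | x y. x \<in> V \<and> y \<in> V \<and> x \<noteq> y}"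
    and connected: "graph_connected V E"
    and acyclic: "\<nexists>p. graph_cycle E p"
    and locally_finite: "\<And>x. x \<in> V \<Longrightarrow> finite (neighbours E x)"
    and root_vertex: "r \<in> V"
    and root_edge: "{e \<in> E. r \<in> e} = {\<omega>}"
    and no_leaves: "\<And>x. x \<in> V \<Longrightarrow> x \<noteq> r \<Longrightarrow> 2 \<le> card {e \<in> E. x \<in> e}"


section \<open>The boundary\<close>

text \<open>An infinite edge path is represented by the sequence of its successive vertices, and the
  edge \<open>\<alpha>\<close> satisfies \<open>\<alpha> < \<zeta>\<close> iff \<open>\<alpha> \<in> geodesic_edges \<zeta>\<close>.\<close>

definition geodesic_edges :: "(nat \<Rightarrow> 'v) \<Rightarrow> 'v set set" where
  "geodesic_edges \<zeta> = {{\<zeta> n, \<zeta> (Suc n)} | n. True}"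

definition tree_boundary :: "'v set set \<Rightarrow> 'v set \<Rightarrow> 'v \<Rightarrow> (nat \<Rightarrow> 'v) set" where
  "tree_boundary E \<omega> r = {\<zeta>. \<zeta> 0 = r \<and> {\<zeta> 0, \<zeta> 1} = \<omega> \<and>
     (\<forall>n. {\<zeta> n, \<zeta> (Suc n)} \<in> E) \<and> (\<forall>n. \<zeta> n \<noteq> \<zeta> (Suc (Suc n)))}"

definition boundary_through :: "'v set set \<Rightarrow> 'v set \<Rightarrow> 'v \<Rightarrow> 'v set \<Rightarrow> (nat \<Rightarrow> 'v) set" where
  "boundary_through E \<omega> r \<alpha> = {\<zeta> \<in> tree_boundary E \<omega> r. \<alpha> \<in> geodesic_edges \<zeta>}"

definition boundary_topology :: "'v set set \<Rightarrow> 'v set \<Rightarrow> 'v \<Rightarrow> (nat \<Rightarrow> 'v) topology" where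
  "boundary_topology E \<omega> r = topology_generated_by (boundary_through E \<omega> r ` E)"


section \<open>Capacity\<close>

definition edge_potential :: "('v set \<Rightarrow> real) \<Rightarrow> (nat \<Rightarrow> 'v) \<Rightarrow> ennreal" where
  "edge_potential f \<zeta> = (\<Sum>\<^sub>\<infinity>\<alpha>\<in>geodesic_edges \<zeta>. ennreal (f \<alpha>))"

definition capacity :: "'v set set \<Rightarrow> (nat \<Rightarrow> 'v) set \<Rightarrow> ennreal" where
  "capacity E A =
     (INF f\<in>{f. (\<forall>\<alpha>\<in>E. 0 \<le> f \<alpha>) \<and> (\<forall>\<zeta>\<in>A. 1 \<le> edge_potential f \<zeta>)}.
        \<Sum>\<^sub>\<infinity>\<alpha>\<in>E. ennreal ((f \<alpha>)\<^sup>2))"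


section \<open>The compactification of the tree by its boundary\<close>

text \<open>\<open>vertices_through E r \<alpha>\<close> is the set of vertices \<open>x\<close> such that the geodesic from the
  root \<open>r\<close> to \<open>x\<close> passes through the edge \<open>\<alpha>\<close>. In the disjoint union of vertices
  (\<open>Inl\<close>) and boundary points (\<open>Inr\<close>), each vertex is isolated, and the neighbourhoods of a
  boundary point \<open>\<zeta>\<close> are generated by the subtrees behind the edges of \<open>\<zeta>\<close> together with
  their boundaries.\<close>

definition vertices_through :: "'v set set \<Rightarrow> 'v \<Rightarrow> 'v set \<Rightarrow> 'v set" where
  "vertices_through E r \<alpha> = {x. \<exists>p. p \<noteq> [] \<and> hd p = r \<and> last p = x \<and>
     successively (\<lambda>u v. {u, v} \<in> E) p \<and>
     (\<forall>i. Suc (Suc i) < length p \<longrightarrow> p ! i \<noteq> p ! Suc (Suc i)) \<and>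
     (\<exists>i. Suc i < length p \<and> \<alpha> = {p ! i, p ! Suc i})}"

definition compactification ::
    "'v set \<Rightarrow> 'v set set \<Rightarrow> 'v set \<Rightarrow> 'v \<Rightarrow> ('v + (nat \<Rightarrow> 'v)) topology" where
  "compactification V E \<omega> r = topology_generated_by
     ((\<lambda>x. {Inl x}) ` V \<union>
      (\<lambda>\<alpha>. Inl ` vertices_through E r \<alpha> \<union> Inr ` boundary_through E \<omega> r \<alpha>) ` E)"

definition exit_points :: "'v set set \<Rightarrow> 'v set \<Rightarrow> 'v \<Rightarrow> ('v + (nat \<Rightarrow> 'v)) set" where
  "exit_points E \<omega> r = insert (Inl r) (Inr ` tree_boundary E \<omega> r)"

definition exit_borel ::
    "'v set \<Rightarrow> 'v set set \<Rightarrow> 'v set \<Rightarrow> 'v \<Rightarrow> ('v + (nat \<Rightarrow> 'v)) measure" where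
  "exit_borel V E \<omega> r = sigma (exit_points E \<omega> r)
     {U. openin (subtopology (compactification V E \<omega> r) (exit_points E \<omega> r)) U}"


section \<open>The simple random walk stopped at the root\<close>

definition walk_step :: "'v set set \<Rightarrow> 'v \<Rightarrow> 'v \<Rightarrow> 'v pmf" where
  "walk_step E r x = (if x = r then return_pmf r else pmf_of_set (neighbours E x))"

definition walk_kernel :: "'v set set \<Rightarrow> 'v \<Rightarrow> 'v \<Rightarrow> nat \<Rightarrow> (nat \<Rightarrow> 'v) \<Rightarrow> 'v measure" where
  "walk_kernel E r x n z =
     measure_pmf (case n of 0 \<Rightarrow> return_pmf x | Suc m \<Rightarrow> walk_step E r (z m))"

text \<open>The law \<open>\<bbbP>\<^sub>x\<close> of the walk on the path space is the Ionescu-Tulcea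
  limit of the transition kernels; the walk itself is the coordinate process.\<close>

definition walk_law :: "'v set set \<Rightarrow> 'v \<Rightarrow> 'v \<Rightarrow> (nat \<Rightarrow> 'v) measure" where
  "walk_law E r x = projective_family.lim UNIV
     (Ionescu_Tulcea.CI (walk_kernel E r x) (\<lambda>_. count_space UNIV)) (\<lambda>_. count_space UNIV)"

interpretation walk: Ionescu_Tulcea "walk_kernel E r x" "\<lambda>_. count_space UNIV"
  for E :: "'v set set" and r x :: 'v
proof (rule Ionescu_Tulcea.intro)
  fix i :: nat
  show "walk_kernel E r x i \<in> measurable (PiM {0..<i} (\<lambda>_. count_space UNIV))
          (subprob_algebra (count_space UNIV))"
  proof (cases i)
    case 0
    have "walk_kernel E r x 0 = (\<lambda>_. measure_pmf (return_pmf x))"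
      by (simp add: walk_kernel_def fun_eq_iff)
    then show ?thesis
      using measure_pmf_in_subprob_algebra[of "return_pmf x"] by (simp add: 0)
  next
    case (Suc m)
    have eq: "walk_kernel E r x i = (\<lambda>z. measure_pmf (walk_step E r (z m)))"
      by (simp add: walk_kernel_def fun_eq_iff Suc)
    have "(\<lambda>z. z m) \<in> measurable (PiM {0..<i} (\<lambda>_. count_space UNIV)) (count_space UNIV)"
      by (rule measurable_component_singleton) (simp add: Suc)
    moreover have "(\<lambda>y. measure_pmf (walk_step E r y)) \<in> measurable (count_space UNIV)
          (subprob_algebra (count_space UNIV))"
      by (simp add: measure_pmf_in_subprob_algebra)
    ultimately show ?thesis
      unfolding eq by (rule measurable_compose)
  qed
next
  fix i and z :: "nat \<Rightarrow> 'v"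
  show "prob_space (walk_kernel E r x i z)"
    unfolding walk_kernel_def by (rule prob_space_measure_pmf)
qed

lemma walk_law_cylinder:
  "emeasure (walk_law E r x) {z. \<forall>i\<le>n. z i = p i} =
     ennreal (indicator {x} (p 0) * (\<Prod>i<n. pmf (walk_step E r (p i)) (p (Suc i))))"
proof -
  let ?M = "\<lambda>_::nat. count_space (UNIV :: 'a set)"
  let ?c = "\<lambda>n. {restrict p {0..<n}}"
  let ?u = "\<lambda>_::nat. undefined :: 'a"
  have u: "?u \<in> space (PiM {0..<0} ?M)"
    by (simp add: space_PiM)
  have sing: "?c n = PiE {0..<n} (\<lambda>i. {p i})" for n
  proof -
    have "PiE {0..<n} (\<lambda>i. {p i}) = PiE {0..<n} (\<lambda>i. {restrict p {0..<n} i})"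
      by (rule PiE_cong) simp
    then show ?thesis
      using PiE_singleton[of "restrict p {0..<n}" "{0..<n}"] by simp
  qed
  have c[measurable]: "?c n \<in> sets (PiM {0..<n} ?M)" for n
    unfolding sing by (rule sets_PiM_I_finite) auto
  have step: "emeasure (walk.C E r x 0 (Suc m) ?u) (?c (Suc m)) =
      emeasure (walk.C E r x 0 m ?u) (?c m) * emeasure (walk_kernel E r x m p) {p m}" for m
  proof -
    have k: "walk_kernel E r x m (restrict p {0..<m}) = walk_kernel E r x m p"
      by (auto simp: walk_kernel_def split: nat.split)
    have eP: "emeasure (walk.eP E r x m z) (?c (Suc m)) =
        emeasure (walk_kernel E r x m p) {p m} * indicator (?c m) z"
      if z: "z \<in> space (PiM {0..<m} ?M)" for z
    proof -
      have ext: "z \<in> extensional {0..<m}"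
        using z by (simp add: space_PiM PiE_def)
      have *: "(\<lambda>y. z(m := y)) -` ?c (Suc m) = (if z \<in> ?c m then {p m} else {})"
      proof -
        have "z(m := y) = restrict p {0..<Suc m} \<longleftrightarrow> z = restrict p {0..<m} \<and> y = p m" for y
        proof
          assume h: "z(m := y) = restrict p {0..<Suc m}"
          have "z i = restrict p {0..<m} i" for i
            using fun_cong[OF h, of i] ext
            by (cases "i < m") (auto simp: extensional_def)
          moreover have "y = p m"
            using fun_cong[OF h, of m] by simp
          ultimately show "z = restrict p {0..<m} \<and> y = p m" by auto
        qed (auto simp: fun_eq_iff)
        then show ?thesis by (cases "z = restrict p {0..<m}") (simp_all add: vimage_def)
      qed
      show ?thesis
      proof (cases "z = restrict p {0..<m}")
        case True
        then show ?thesis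
          by (subst walk.emeasure_eP[OF z c]) (simp add: k *[unfolded True] del: restrict_apply)
      next
        case False
        then show ?thesis
          by (subst walk.emeasure_eP[OF z c]) (simp add: *)
      qed
    qed
    have "emeasure (walk.C E r x 0 (Suc m) ?u) (?c (Suc m)) =
        (\<integral>\<^sup>+ z. emeasure (walk.eP E r x m z) (?c (Suc m)) \<partial>walk.C E r x 0 m ?u)"
      using walk.space_C[OF u, of E r x m] u
      by (subst walk.C.simps, subst emeasure_bind[where N="PiM {0..<Suc m} ?M"])
         (auto simp: space_PiM_empty_iff measurable_cong_sets[OF walk.sets_C refl] intro!: walk.measurable_eP)
    also have "\<dots> = (\<integral>\<^sup>+ z. emeasure (walk_kernel E r x m p) {p m} * indicator (?c m) z \<partial>walk.C E r x 0 m ?u)"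
      by (rule nn_integral_cong) (use walk.space_C[OF u, of E r x m] eP in auto)
    also have "\<dots> = emeasure (walk_kernel E r x m p) {p m} * emeasure (walk.C E r x 0 m ?u) (?c m)"
      using c[of m] walk.sets_C[OF u, of E r x m] by (subst nn_integral_cmult_indicator) auto
    finally show ?thesis by (simp add: mult.commute)
  qed
  have C: "emeasure (walk.C E r x 0 (Suc n) ?u) (?c (Suc n)) =
      ennreal (indicator {x} (p 0) * (\<Prod>i<n. pmf (walk_step E r (p i)) (p (Suc i))))" for n
  proof (induction n)
    case 0
    have "?u \<in> ?c 0" by (auto simp: restrict_def)
    then have "emeasure (walk.C E r x 0 0 ?u) (?c 0) = 1"
      using c[of 0] by simp
    then show ?case
      by (subst step) (simp add: walk_kernel_def emeasure_pmf_single pmf_return indicator_def)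
  next
    case (Suc n)
    have "emeasure (walk_kernel E r x (Suc n) p) {p (Suc n)} =
        ennreal (pmf (walk_step E r (p n)) (p (Suc n)))"
      by (simp add: walk_kernel_def emeasure_pmf_single)
    then show ?case
      by (subst step, subst Suc.IH)
         (simp only: ennreal_mult''[symmetric] pmf_nonneg prod.lessThan_Suc mult.assoc)
  qed
  have emb: "prod_emb UNIV ?M {0..<Suc n} (?c (Suc n)) = {z. \<forall>i\<le>n. z i = p i}"
    by (auto simp: prod_emb_def space_PiM restrict_def fun_eq_iff less_Suc_eq_le split: if_splits)
  have "walk.CI E r x {0..<Suc n} (?c (Suc n)) = walk.C E r x 0 (Suc n) ?u (prod_emb {0..<Suc n} ?M {0..<Suc n} (?c (Suc n)))"
    by (rule walk.emeasure_CI) auto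
  also have "prod_emb {0..<Suc n} ?M {0..<Suc n} (?c (Suc n)) = ?c (Suc n)"
    by (rule prod_emb_id) (auto simp: space_PiM)
  finally show ?thesis
    using walk.lim[OF finite_atLeastLessThan c[of "Suc n"], of E r x] C[of n]
    by (simp only: walk_law_def emb)
qed


section \<open>Harmonic measure and Poisson integral\<close>

text \<open>The limit \<open>Z\<^sub>\<infinity>\<close> of a path in the compactification. On the null set of paths
  converging neither to the root nor to a boundary point it is set to the root.\<close>

definition walk_limit :: "'v set \<Rightarrow> 'v set set \<Rightarrow> 'v set \<Rightarrow> 'v \<Rightarrow> (nat \<Rightarrow> 'v) \<Rightarrow> 'v + (nat \<Rightarrow> 'v)" where
  "walk_limit V E \<omega> r z =
     (let is_limit = \<lambda>l. l \<in> exit_points E \<omega> r \<and>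
            limitin (compactification V E \<omega> r) (\<lambda>n. Inl (z n)) l sequentially
      in if \<exists>l. is_limit l then THE l. is_limit l else Inl r)"

definition harmonic_measure ::
    "'v set \<Rightarrow> 'v set set \<Rightarrow> 'v set \<Rightarrow> 'v \<Rightarrow> 'v \<Rightarrow> ('v + (nat \<Rightarrow> 'v)) measure" where
  "harmonic_measure V E \<omega> r x =
     distr (walk_law E r x) (exit_borel V E \<omega> r) (walk_limit V E \<omega> r)"

definition poisson_integral ::
    "'v set \<Rightarrow> 'v set set \<Rightarrow> 'v set \<Rightarrow> 'v \<Rightarrow> ((nat \<Rightarrow> 'v) \<Rightarrow> real) \<Rightarrow> 'v \<Rightarrow> real" where
  "poisson_integral V E \<omega> r \<phi> x =
     (LINT l:Inr ` tree_boundary E \<omega> r|harmonic_measure V E \<omega> r x. \<phi> (projr l))"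

end

theory Submission
  imports Defs
begin

text \<open>
  Let \<open>h\<close> be the probability that the walk hits the root. If \<open>h(\<zeta>\<^sub>j) \<longrightarrow> 0\<close>
  along the vertices of \<open>\<zeta>\<close>, then \<open>\<zeta>\<close> is regular: for a vertex \<open>v\<close> of \<open>\<zeta>\<close>
  the function equal to \<open>min 1 (h / h v)\<close> behind \<open>v\<close> and to \<open>1\<close> elsewhere is superharmonic,
  hence bounds the probability that the walk does not converge to a boundary point behind \<open>v\<close>.

  The points where \<open>h\<close> does not tend to \<open>0\<close> form a set of capacity zero. Let \<open>h\<^sub>n\<close> be the
  probability of hitting the root before level \<open>n\<close>, and let \<open>f\<^sub>n\<close>, \<open>f\<close> be the decrements of
  \<open>h\<^sub>n\<close>, \<open>h\<close> along the edges. These are flows on the tree, and summation by parts gives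
  \<open>\<parallel>f\<^sub>n - f\<parallel>\<^sup>2 \<le> f\<^sub>n(\<omega>) - f(\<omega>) \<longrightarrow> 0\<close>, whereas the sum of \<open>f\<^sub>n - f\<close> along \<open>\<zeta>\<close> is
  \<open>lim\<^sub>j h(\<zeta>\<^sub>j)\<close> for every \<open>n\<close>. Summing \<open>|f\<^sub>n - f|\<close> over a sparse sequence of \<open>n\<close> yields functions
  of arbitrarily small energy with infinite potential at all these points.
\<close>

section \<open>Geodesics from the root\<close>

text \<open>The recursive form suits inductions over lists; \<open>nonbacktracking_iff_nth\<close>
  links it to the indexed condition in \<open>vertices_through\<close>.\<close>

fun nonbacktracking :: "'a list \<Rightarrow> bool" where
  "nonbacktracking (a # b # c # xs) \<longleftrightarrow> a \<noteq> c \<and> nonbacktracking (b # c # xs)"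
| "nonbacktracking _ \<longleftrightarrow> True"

lemma nonbacktracking_iff_nth:
  "nonbacktracking p \<longleftrightarrow> (\<forall>i. Suc (Suc i) < length p \<longrightarrow> p ! i \<noteq> p ! Suc (Suc i))"
proof (induction p rule: nonbacktracking.induct)
  case (1 a b c xs)
  have "(\<forall>i. P i) \<longleftrightarrow> P 0 \<and> (\<forall>i. P (Suc i))" for P :: "nat \<Rightarrow> bool"
    by (metis not0_implies_Suc)
  from this[of "\<lambda>i. Suc (Suc i) < length (a # b # c # xs) \<longrightarrow>
      (a # b # c # xs) ! i \<noteq> (a # b # c # xs) ! Suc (Suc i)"]
  show ?case using 1 by simp
qed auto

text \<open>Only triples of consecutive entries matter, and \<open>a, c, b\<close> is the single
  triple contained in neither of the two overlapping pieces.\<close>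

lemma nonbacktracking_append:
  "nonbacktracking (xs @ [a, c, b] @ ys) \<longleftrightarrow>
     nonbacktracking (xs @ [a, c]) \<and> a \<noteq> b \<and> nonbacktracking ([c, b] @ ys)"
proof (induction xs rule: nonbacktracking.induct)
  case ("2_3" v va)
  then show ?case by (cases ys) auto
qed auto

lemma nonbacktracking_rev: "nonbacktracking (rev p) = nonbacktracking p"
proof (induction p rule: nonbacktracking.induct)
  case (1 a b c xs)
  have "nonbacktracking (rev (a # b # c # xs)) = nonbacktracking (rev xs @ [c, b, a] @ [])"
    by simp
  also have "\<dots> \<longleftrightarrow> nonbacktracking (rev xs @ [c, b]) \<and> c \<noteq> a"
    unfolding nonbacktracking_append by simp
  finally show ?case using 1 by auto
qed auto

lemma nonbacktracking_take: "nonbacktracking p \<Longrightarrow> nonbacktracking (take n p)"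
  by (simp add: nonbacktracking_iff_nth)

lemma successively_take: "successively P p \<Longrightarrow> successively P (take n p)"
  by (metis append_take_drop_id successively_append_iff)

context rooted_tree
begin

section \<open>Uniqueness and existence of geodesics\<close>

abbreviation adj :: "'v \<Rightarrow> 'v \<Rightarrow> bool" where "adj u v \<equiv> {u, v} \<in> E"

lemma adj_vertices: "adj u v \<Longrightarrow> u \<in> V" "adj u v \<Longrightarrow> v \<in> V" "adj u v \<Longrightarrow> u \<noteq> v"
  using edges by (auto simp: doubleton_eq_iff)

lemma adj_sym: "adj u v \<Longrightarrow> adj v u"
  by (simp add: insert_commute)

definition geodesic :: "'v list \<Rightarrow> bool" where
  "geodesic p \<longleftrightarrow> p \<noteq> [] \<and> successively adj p \<and> nonbacktracking p"

text \<open>At the first index j repeating an earlier vertex, the segment from that vertex up to j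
  would be a cycle: minimality of j makes it distinct, and it has at least three vertices because
  there are neither loops nor backtracking.\<close>

lemma geodesic_distinct:
  assumes "geodesic p" shows "distinct p"
proof (rule ccontr)
  let ?P = "\<lambda>j. j < length p \<and> (\<exists>i<j. p ! i = p ! j)"
  assume "\<not> distinct p"
  then obtain i0 j0 where "i0 < length p" "j0 < length p" "i0 \<noteq> j0" "p ! i0 = p ! j0"
    by (auto simp: distinct_conv_nth)
  then have ex: "\<exists>j. ?P j"
    by (metis linorder_neqE_nat)
  define j where "j = (LEAST j. ?P j)"
  have j: "?P j" unfolding j_def using ex by (rule LeastI_ex)
  then obtain i where i: "i < j" "p ! i = p ! j" by blast
  have min: "\<not> ?P k" if "k < j" for k
    using that unfolding j_def by (rule not_less_Least)
  have s: "adj (p ! k) (p ! Suc k)" if "Suc k < length p" for k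
    using assms that by (auto simp: geodesic_def successively_conv_nth)
  have nb: "p ! k \<noteq> p ! Suc (Suc k)" if "Suc (Suc k) < length p" for k
    using assms that by (auto simp: geodesic_def nonbacktracking_iff_nth)
  have "j \<noteq> Suc i" using s[of i] i j adj_vertices(3) by metis
  moreover have "j \<noteq> Suc (Suc i)" using nb[of i] i j by metis
  ultimately have len: "3 \<le> j - i" using i by linarith
  let ?c = "map ((!) p) [i..<j]"
  have "distinct ?c"
    unfolding distinct_map
  proof (intro conjI inj_onI)
    fix a b assume "a \<in> set [i..<j]" "b \<in> set [i..<j]" "p ! a = p ! b"
    then show "a = b" using min[of a] min[of b] j
      by (metis atLeastLessThan_iff linorder_neqE_nat order.strict_trans set_upt)
  qed simp
  moreover have "successively adj ?c"
    using s j by (auto simp: successively_conv_nth)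
  moreover have "{last ?c, hd ?c} \<in> E"
  proof -
    have "adj (p ! (j - 1)) (p ! j)" using s[of "j - 1"] i j by simp
    moreover have "last ?c = p ! (j - 1)" using i by (subst last_map) auto
    moreover have "hd ?c = p ! j" using i by (subst hd_map) auto
    ultimately show ?thesis by simp
  qed
  ultimately have "graph_cycle E ?c" using len by (simp add: graph_cycle_def)
  then show False using acyclic by blast
qed

text \<open>Two geodesics with the same end are compared from the back. If their next-to-last
  vertices differ, running along one and back along the other is a geodesic that returns to its
  start, against \<open>geodesic_distinct\<close>.\<close>

lemma geodesic_unique:
  assumes "geodesic p" "geodesic q" "hd p = hd q" "last p = last q"
  shows "p = q"
  using assms
proof (induction p arbitrary: q rule: rev_induct)
  case Nil then show ?case by (simp add: geodesic_def)
next
  case (snoc c p' q)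
  define q' where "q' = butlast q"
  have q: "q = q' @ [c]"
    using snoc.prems by (metis append_butlast_last_id geodesic_def last_snoc q'_def)
  have dp: "distinct (p' @ [c])" and dq: "distinct (q' @ [c])"
    using geodesic_distinct[OF snoc.prems(1)] geodesic_distinct[OF snoc.prems(2)] q by auto
  consider "p' = []" | "q' = []" | "p' \<noteq> []" "q' \<noteq> []" by blast
  then show ?case
  proof cases
    case 1
    then have "hd q = c" using snoc.prems by simp
    then have "q' = []" using dq q by (cases q') auto
    then show ?thesis using 1 q by simp
  next
    case 2
    then have "hd (p' @ [c]) = c" using snoc.prems q by simp
    then have "p' = []" using dp by (cases p') auto
    then show ?thesis using 2 q by simp
  next
    case 3
    have gp: "geodesic p'" and gq: "geodesic q'"
      using 3 snoc.prems(1,2) nonbacktracking_take[of "p' @ [c]" "length p'"]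
        nonbacktracking_take[of "q' @ [c]" "length q'"]
      by (auto simp: geodesic_def successively_append_iff q)
    have heq: "hd p' = hd q'" using 3 snoc.prems q by simp
    show ?thesis
    proof (cases "last p' = last q'")
      case True
      then have "p' = q'" using snoc.IH[OF gp gq] heq by simp
      then show ?thesis using q by simp
    next
      case False
      obtain p'' a where p': "p' = p'' @ [a]" using 3 by (metis rev_exhaust)
      obtain q'' b where q': "q' = q'' @ [b]" using 3 by (metis rev_exhaust)
      \<comment> \<open>Forward along \<open>p\<close> to \<open>c\<close>, then back along
        \<open>q\<close>; the turn at \<open>c\<close> is not a backtracking because
        \<open>a\<close> and \<open>b\<close> differ.\<close>
      let ?w = "p'' @ [a, c, b] @ rev q''"
      have "successively adj (rev q)"
        using snoc.prems(2) adj_sym by (auto simp: geodesic_def successively_rev insert_commute)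
      moreover have "nonbacktracking (rev q)"
        using snoc.prems(2) by (simp add: geodesic_def nonbacktracking_rev)
      ultimately have "geodesic ?w"
        using snoc.prems(1) False unfolding geodesic_def nonbacktracking_append
        by (auto simp: q q' p' successively_append_iff)
      then have "distinct ?w" by (rule geodesic_distinct)
      moreover have "hd ?w \<in> set (p'' @ [a])" by (cases p'') auto
      moreover have "hd ?w = hd p'" using p' by (cases p'') auto
      moreover have "hd q' \<in> set (b # rev q'')" using q' by (cases q'') auto
      ultimately show ?thesis using heq by auto
    qed
  qed
qed

definition gpath :: "'v \<Rightarrow> 'v list" where
  "gpath x = (THE p. geodesic p \<and> hd p = r \<and> last p = x)"

lemma gpath_eqI:
  assumes "geodesic p" "hd p = r" "last p = x"
  shows "gpath x = p"
  unfolding gpath_def using assms geodesic_unique by (intro the_equality) auto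

lemma geodesic_take: "geodesic p \<Longrightarrow> geodesic (take (Suc i) p)"
  by (cases p) (auto simp: geodesic_def successively_take nonbacktracking_take simp del: take_Suc_Cons)

text \<open>The only obstruction to appending \<open>y\<close> is that \<open>y\<close> already
  precedes \<open>last p\<close>; removing \<open>last p\<close> then leaves a geodesic to
  \<open>y\<close>. This dichotomy is the source of the parent-child structure.\<close>

lemma geodesic_extend:
  assumes "geodesic p" "hd p = r" "adj (last p) y"
  shows "geodesic (p @ [y]) \<or> (\<exists>p'. p = p' @ [last p] \<and> geodesic p' \<and> hd p' = r \<and> last p' = y)"
proof (cases "nonbacktracking (p @ [y])")
  case True
  then show ?thesis using assms by (auto simp: geodesic_def successively_append_iff)
next
  case False
  have "\<exists>p'' a. p = p'' @ [a, last p]"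
  proof (rule ccontr)
    assume a: "\<not> ?thesis"
    have pb: "p = butlast p @ [last p]" using assms by (simp add: geodesic_def)
    have "butlast p = []"
      using a pb by (metis append.assoc append_Cons append_Nil append_butlast_last_id)
    then have "p = [last p]" using pb by simp
    then have "nonbacktracking (p @ [y])" by (metis append_Cons append_Nil nonbacktracking.simps(4))
    with False show False by simp
  qed
  then obtain p'' a where p: "p = p'' @ [a, last p]" by blast
  have "nonbacktracking (p @ [y]) \<longleftrightarrow> nonbacktracking (p'' @ [a, last p] ) \<and> a \<noteq> y"
    using nonbacktracking_append[of p'' a "last p" y "[]"] p
    by (metis append.assoc append_Cons append_Nil nonbacktracking.simps(4) append_Nil2 nonbacktracking.simps(3))
  then have ay: "a = y" using False p assms(1) by (metis geodesic_def)
  have "geodesic (p'' @ [a])"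
    using geodesic_take[OF assms(1), of "length p''"] by (subst (asm) p) simp
  moreover have "hd (p'' @ [a]) = r" using assms(2) p by (metis append.assoc append_Cons append_Nil
     hd_append2 snoc_eq_iff_butlast)
  ultimately show ?thesis using p ay by (metis append.assoc append_Cons append_Nil last_snoc)
qed

text \<open>By \<open>geodesic_extend\<close>, reachability by a geodesic from the root passes from
  a vertex to its neighbours, hence along any connecting path.\<close>

lemma geodesic_exists:
  assumes "x \<in> V"
  shows "\<exists>p. geodesic p \<and> hd p = r \<and> last p = x"
proof -
  let ?R = "\<lambda>x. \<exists>p. geodesic p \<and> hd p = r \<and> last p = x"
  have step: "?R v" if "?R u" "adj u v" for u v
    using that geodesic_extend[of _ v] by (metis geodesic_def hd_append2 last_snoc)
  have "?R (last p)" if "p \<noteq> []" "?R (hd p)" "successively adj p" for p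
    using that
  proof (induction p rule: induct_list012)
    case (3 x y zs)
    then show ?case using step[of x y] by simp
  qed auto
  moreover have "?R r" by (rule exI[of _ "[r]"]) (simp add: geodesic_def)
  ultimately show ?thesis
    using connected assms root_vertex unfolding graph_connected_def by metis
qed

lemma gpath:
  assumes "x \<in> V"
  shows "geodesic (gpath x)" "hd (gpath x) = r" "last (gpath x) = x" "gpath x \<noteq> []"
  using geodesic_exists[OF assms] gpath_eqI by (auto simp: geodesic_def)

lemma gpath_adj:
  assumes "adj x y"
  shows "gpath y = gpath x @ [y] \<or> gpath x = gpath y @ [x]"
proof -
  note g = gpath[OF adj_vertices(1)[OF assms]]
  from geodesic_extend[of "gpath x" y] g assms
  consider "geodesic (gpath x @ [y])"
    | p' where "gpath x = p' @ [x]" "geodesic p'" "hd p' = r" "last p' = y"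
    by auto
  then show ?thesis
  proof cases
    case 1
    then have "gpath y = gpath x @ [y]" using g by (intro gpath_eqI) auto
    then show ?thesis ..
  next
    case 2
    then have "gpath y = p'" by (intro gpath_eqI) auto
    with 2 show ?thesis by simp
  qed
qed

lemma gpath_nth:
  assumes "x \<in> V" "i < length (gpath x)"
  shows "gpath (gpath x ! i) = take (Suc i) (gpath x)"
  using gpath[OF assms(1)] assms(2) geodesic_take[of "gpath x" i]
  by (intro gpath_eqI) (auto simp: last_conv_nth)

lemma gpath_subset:
  assumes "x \<in> V" shows "set (gpath x) \<subseteq> V"
proof
  fix y assume "y \<in> set (gpath x)"
  then obtain i where i: "i < length (gpath x)" "y = gpath x ! i" by (metis in_set_conv_nth)
  have s: "adj (gpath x ! k) (gpath x ! Suc k)" if "Suc k < length (gpath x)" for k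
    using gpath(1)[OF assms] that by (auto simp: geodesic_def successively_conv_nth)
  show "y \<in> V"
  proof (cases "Suc i < length (gpath x)")
    case True then show ?thesis using s i adj_vertices by metis
  next
    case False
    then have "y = last (gpath x)" using i gpath(4)[OF assms]
      by (metis Suc_lessI diff_Suc_1 last_conv_nth)
    then show ?thesis using gpath(3)[OF assms] assms by simp
  qed
qed

section \<open>Levels, parents and children\<close>

definition lev :: "'v \<Rightarrow> nat" where "lev x = length (gpath x) - 1"

text \<open>At the root truncated subtraction gives \<open>par r = r\<close>, hence the condition
  \<open>x \<noteq> r\<close> in the facts on parents.\<close>

definition par :: "'v \<Rightarrow> 'v" where "par x = gpath x ! (lev x - 1)"

definition ch :: "'v \<Rightarrow> 'v set" where "ch x = {y. adj x y \<and> gpath y = gpath x @ [y]}"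

lemma length_gpath: "x \<in> V \<Longrightarrow> length (gpath x) = Suc (lev x)"
  using gpath(4)[of x] by (simp add: lev_def)

lemma gpath_lev: "x \<in> V \<Longrightarrow> gpath x ! lev x = x"
  using gpath(3,4)[of x] by (simp add: lev_def last_conv_nth)

lemma gpath_0: "x \<in> V \<Longrightarrow> gpath x ! 0 = r"
  using gpath(2,4)[of x] by (simp add: hd_conv_nth)

lemma gpath_root: "gpath r = [r]"
  by (rule gpath_eqI) (auto simp: geodesic_def)

lemma lev_root: "lev r = 0"
  by (simp add: lev_def gpath_root)

lemma lev_eq_0: "x \<in> V \<Longrightarrow> lev x = 0 \<longleftrightarrow> x = r"
  using gpath_lev[of x] gpath_0[of x] lev_root by auto

lemma lev_nth:
  assumes "x \<in> V" "i \<le> lev x"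
  shows "lev (gpath x ! i) = i" "gpath x ! i \<in> V"
proof -
  have i: "i < length (gpath x)" using assms length_gpath by simp
  show "lev (gpath x ! i) = i"
    using gpath_nth[OF assms(1) i] i by (simp add: lev_def)
  show "gpath x ! i \<in> V" using gpath_subset[OF assms(1)] i by auto
qed

lemma childD:
  assumes "y \<in> ch x"
  shows "adj x y" "x \<in> V" "y \<in> V" "gpath y = gpath x @ [y]" "lev y = Suc (lev x)" "par y = x" "y \<noteq> r"
proof -
  show a: "adj x y" and g: "gpath y = gpath x @ [y]" using assms by (auto simp: ch_def)
  show x: "x \<in> V" and "y \<in> V" using adj_vertices[OF a] by auto
  show l: "lev y = Suc (lev x)" using g length_gpath[OF x] by (simp add: lev_def)
  show "par y = x" using g l gpath_lev[OF x] length_gpath[OF x] by (simp add: par_def nth_append)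
  show "y \<noteq> r" using l lev_root by auto
qed

lemma child_par:
  assumes "x \<in> V" "x \<noteq> r"
  shows "x \<in> ch (par x)"
proof -
  have l: "0 < lev x" using assms lev_eq_0 by auto
  have s: "adj (gpath x ! k) (gpath x ! Suc k)" if "Suc k < length (gpath x)" for k
    using gpath(1)[OF assms(1)] that by (auto simp: geodesic_def successively_conv_nth)
  have "adj (par x) x"
    using s[of "lev x - 1"] l length_gpath[OF assms(1)] gpath_lev[OF assms(1)] by (simp add: par_def)
  moreover have "gpath (par x) = take (lev x) (gpath x)"
    using gpath_nth[OF assms(1), of "lev x - 1"] l length_gpath[OF assms(1)] by (simp add: par_def)
  moreover have "gpath x = take (lev x) (gpath x) @ [gpath x ! lev x]"
    using length_gpath[OF assms(1)] by (metis lessI order_refl take_Suc_conv_app_nth take_all)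
  ultimately show ?thesis using gpath_lev[OF assms(1)] by (simp add: ch_def)
qed

lemma par_in: "x \<in> V \<Longrightarrow> x \<noteq> r \<Longrightarrow> par x \<in> V"
  using child_par childD by blast

lemma lev_par: "x \<in> V \<Longrightarrow> x \<noteq> r \<Longrightarrow> lev x = Suc (lev (par x))"
  using child_par childD by blast

lemma adj_cases:
  assumes "adj x y" shows "y \<in> ch x \<or> x \<in> ch y"
  using gpath_adj[OF assms] assms adj_sym[OF assms] by (auto simp: ch_def)

lemma neighbours_eq:
  assumes "x \<in> V" "x \<noteq> r"
  shows "neighbours E x = insert (par x) (ch x)"
proof (intro equalityI subsetI)
  fix y assume "y \<in> neighbours E x"
  then have "adj x y" by (simp add: neighbours_def)
  then show "y \<in> insert (par x) (ch x)" using adj_cases[of x y] childD(6)[of x y] by blast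
next
  fix y assume "y \<in> insert (par x) (ch x)"
  then show "y \<in> neighbours E x"
    using childD(1)[OF child_par[OF assms]] childD(1)[of y x]
    by (auto simp: neighbours_def insert_commute)
qed

lemma par_notin_ch:
  assumes "x \<in> V" "x \<noteq> r"
  shows "par x \<notin> ch x"
proof
  assume "par x \<in> ch x"
  then have "lev (par x) = Suc (lev x)" by (rule childD(5))
  then show False using lev_par[OF assms] by simp
qed

lemma finite_ch: "finite (ch x)"
proof (cases "x \<in> V")
  case True
  have "ch x \<subseteq> neighbours E x" by (auto simp: ch_def neighbours_def)
  then show ?thesis using locally_finite[OF True] by (rule finite_subset)
next
  case False then show ?thesis using childD by (metis equals0I finite.emptyI)
qed

lemma ch_disjoint: "x \<noteq> y \<Longrightarrow> ch x \<inter> ch y = {}"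
  using childD(6) by blast

definition level :: "nat \<Rightarrow> 'v set" where "level n = {x \<in> V. lev x = n}"

lemma level_0: "level 0 = {r}"
  using lev_eq_0 root_vertex by (auto simp: level_def)

lemma level_Suc: "level (Suc n) = (\<Union>x\<in>level n. ch x)"
proof (intro equalityI subsetI)
  fix x assume x: "x \<in> level (Suc n)"
  then have "x \<noteq> r" using lev_root by (auto simp: level_def)
  then show "x \<in> (\<Union>x\<in>level n. ch x)"
    using x child_par[of x] par_in[of x] lev_par[of x] by (auto simp: level_def)
qed (auto simp: level_def dest: childD)

lemma finite_level: "finite (level n)"
  by (induction n) (auto simp: level_0 level_Suc finite_ch)

lemma sum_level_Suc: "(\<Sum>y\<in>level (Suc n). F y) = (\<Sum>x\<in>level n. \<Sum>y\<in>ch x. F y)"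
  unfolding level_Suc by (rule sum.UNION_disjoint) (simp_all add: finite_level finite_ch ch_disjoint)

lemma V_eq_levels: "V = (\<Union>n. level n)"
  by (auto simp: level_def)

lemma countable_V: "countable V"
  by (subst V_eq_levels) (simp add: countable_finite finite_level)

text \<open>Edges are parametrised by their lower endpoint. Together with \<open>inj_edge\<close>
  this turns sums over edges into sums over the vertices other than the root.\<close>

lemma E_eq: "E = (\<lambda>x. {par x, x}) ` (V - {r})"
proof (intro equalityI subsetI)
  fix e assume e: "e \<in> E"
  then have "e \<in> {{x, y} | x y. x \<in> V \<and> y \<in> V \<and> x \<noteq> y}" using edges by (rule subsetD[rotated])
  then obtain x y where xy: "e = {x, y}" by blast
  have "y \<in> ch x \<or> x \<in> ch y" using e unfolding xy by (rule adj_cases)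
  then show "e \<in> (\<lambda>x. {par x, x}) ` (V - {r})"
  proof
    assume "y \<in> ch x"
    note c = childD[OF this]
    show ?thesis by (rule image_eqI[of _ _ y]) (simp_all add: c xy)
  next
    assume "x \<in> ch y"
    note c = childD[OF this]
    show ?thesis by (rule image_eqI[of _ _ x]) (simp_all add: c xy insert_commute)
  qed
next
  fix e assume "e \<in> (\<lambda>x. {par x, x}) ` (V - {r})"
  then obtain x where x: "x \<in> V" "x \<noteq> r" "e = {par x, x}" by blast
  show "e \<in> E" unfolding x(3) by (rule childD(1)[OF child_par[OF x(1,2)]])
qed

lemma inj_edge: "inj_on (\<lambda>x. {par x, x}) (V - {r})"
proof (rule inj_onI)
  fix x y assume a: "x \<in> V - {r}" "y \<in> V - {r}" "{par x, x} = {par y, y}"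
  then have "x = y \<or> (x = par y \<and> y = par x)" by (auto simp: doubleton_eq_iff)
  then show "x = y" using a lev_par[of x] lev_par[of y] by auto
qed

section \<open>Subtrees and boundary cylinders\<close>

definition below :: "'v \<Rightarrow> 'v set" where
  "below v = {y \<in> V. lev v \<le> lev y \<and> gpath y ! lev v = v}"

lemma below_self: "v \<in> V \<Longrightarrow> v \<in> below v"
  by (simp add: below_def gpath_lev)

lemma below_child:
  assumes "y \<in> ch x" "x \<in> below v" shows "y \<in> below v"
  using assms childD[OF assms(1)] length_gpath[of x] by (auto simp: below_def nth_append)

lemma below_par:
  assumes "x \<in> below v" "x \<noteq> v" "v \<in> V" shows "par x \<in> below v" "x \<noteq> r"
proof -
  have x: "x \<in> V" using assms by (simp add: below_def)
  have "lev v \<noteq> lev x" using assms gpath_lev[OF x] by (auto simp: below_def)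
  then have l: "lev v < lev x" using assms by (auto simp: below_def)
  show nr: "x \<noteq> r" using l lev_root by auto
  note c = childD[OF child_par[OF x nr]]
  show "par x \<in> below v" using assms l c length_gpath[of "par x"] by (auto simp: below_def nth_append)
qed

text \<open>Initial segments of a boundary point are geodesics from the root, so every step goes to
  a child. Conversely, the levels increase strictly, which excludes backtracking, and the first edge
  is \<omega> because the root has no other.\<close>

lemma boundary_iff:
  "\<zeta> \<in> tree_boundary E \<omega> r \<longleftrightarrow> \<zeta> 0 = r \<and> (\<forall>n. \<zeta> (Suc n) \<in> ch (\<zeta> n))" (is "?L \<longleftrightarrow> ?R")
proof
  assume L: ?L
  have g: "geodesic (map \<zeta> [0..<Suc n])" for n
    using L unfolding geodesic_def nonbacktracking_iff_nth successively_conv_nth tree_boundary_def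
    by (auto simp del: upt_Suc)
  have gp: "gpath (\<zeta> n) = map \<zeta> [0..<Suc n]" for n
    using L by (intro gpath_eqI[OF g]) (simp_all add: tree_boundary_def hd_map last_map del: upt_Suc)
  show ?R
    using L gp by (auto simp: ch_def tree_boundary_def)
next
  assume R: ?R
  have "\<zeta> n \<noteq> \<zeta> (Suc (Suc n))" for n
    using R childD(5) by (metis Suc_n_not_le_n le_SucI order_refl)
  moreover have "{r, \<zeta> (Suc 0)} = \<omega>"
    using R childD(1)[of "\<zeta> 1" r] root_edge by (metis (mono_tags, lifting) One_nat_def insertI1 mem_Collect_eq singletonD)
  ultimately show ?L using R childD(1) by (auto simp: tree_boundary_def)
qed

lemma boundary_gpath:
  assumes "\<zeta> \<in> tree_boundary E \<omega> r"
  shows "\<zeta> n \<in> V" "lev (\<zeta> n) = n" "gpath (\<zeta> n) = map \<zeta> [0..<Suc n]"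
proof -
  have z: "\<zeta> 0 = r" "\<zeta> (Suc n) \<in> ch (\<zeta> n)" for n using assms by (auto simp: boundary_iff)
  show "\<zeta> n \<in> V" using z root_vertex childD(3) by (metis not0_implies_Suc)
  show "lev (\<zeta> n) = n" using z(1) childD(5)[OF z(2)] lev_root by (induction n) simp_all
  show "gpath (\<zeta> n) = map \<zeta> [0..<Suc n]" using z(1) childD(4)[OF z(2)] gpath_root by (induction n) simp_all
qed

text \<open>Indexing by a vertex instead of an edge makes \<open>cyl r\<close> the whole boundary;
  for other vertices it is the basic open set of the edge from the parent to
  \<open>v\<close>.\<close>

definition cyl :: "'v \<Rightarrow> (nat \<Rightarrow> 'v) set" where
  "cyl v = {\<zeta> \<in> tree_boundary E \<omega> r. \<zeta> (lev v) = v}"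

lemma cyl_iff_edge:
  assumes "v \<in> V" "v \<noteq> r" "\<zeta> \<in> tree_boundary E \<omega> r"
  shows "{par v, v} \<in> geodesic_edges \<zeta> \<longleftrightarrow> \<zeta> (lev v) = v"
proof
  have b: "\<zeta> n \<in> V" "lev (\<zeta> n) = n" "\<zeta> (Suc n) \<in> ch (\<zeta> n)" for n
    using assms boundary_gpath boundary_iff by auto
  { assume "{par v, v} \<in> geodesic_edges \<zeta>"
    then obtain n where n: "{par v, v} = {\<zeta> n, \<zeta> (Suc n)}" by (auto simp: geodesic_edges_def)
    have "{par (\<zeta> (Suc n)), \<zeta> (Suc n)} = {par v, v}" using n childD(6)[OF b(3)] by simp
    moreover have "\<zeta> (Suc n) \<in> V - {r}" using b childD(7)[OF b(3)] by auto
    ultimately have "\<zeta> (Suc n) = v" using inj_edge assms by (auto simp: inj_on_def)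
    then show "\<zeta> (lev v) = v" using b by auto }
  assume a: "\<zeta> (lev v) = v"
  obtain n where n: "lev v = Suc n" using assms lev_par by blast
  then have "{par v, v} = {\<zeta> n, \<zeta> (Suc n)}" using childD(6)[OF b(3), of n] a by simp
  then show "{par v, v} \<in> geodesic_edges \<zeta>" by (auto simp: geodesic_edges_def)
qed

lemma boundary_through_eq:
  assumes "v \<in> V" "v \<noteq> r"
  shows "boundary_through E \<omega> r {par v, v} = cyl v"
  using cyl_iff_edge[OF assms] by (auto simp: boundary_through_def cyl_def)

text \<open>The path in \<open>vertices_through\<close> is \<open>gpath x\<close> by uniqueness, and
  each of its edges joins a parent to a child; \<open>inj_edge\<close> then identifies the child
  with \<open>v\<close>.\<close>

lemma vertices_through_eq:
  assumes "v \<in> V" "v \<noteq> r"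
  shows "vertices_through E r {par v, v} = below v"
proof (intro equalityI subsetI)
  fix x assume "x \<in> vertices_through E r {par v, v}"
  then obtain p i where p: "geodesic p" "hd p = r" "last p = x"
    and i: "Suc i < length p" "{par v, v} = {p ! i, p ! Suc i}"
    by (auto simp: vertices_through_def geodesic_def nonbacktracking_iff_nth)
  have g: "gpath x = p" using p by (rule gpath_eqI)
  \<comment> \<open>\<open>vertices_through\<close> does not mention \<open>V\<close>; the last edge
    of \<open>p\<close> shows that its end \<open>x\<close> is a vertex.\<close>
  have "adj (p ! (length p - 2)) (p ! Suc (length p - 2))"
    using p(1) i(1) unfolding geodesic_def successively_conv_nth by simp
  moreover have "p ! Suc (length p - 2) = x"
    using p(1,3) i(1) by (simp add: geodesic_def last_conv_nth Suc_diff_Suc numeral_2_eq_2)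
  ultimately have "adj (p ! (length p - 2)) x" by simp
  then have x: "x \<in> V" using adj_vertices by blast
  have l: "Suc i \<le> lev x" using length_gpath[OF x] g i by simp
  note n = lev_nth[OF x l]
  have nr: "p ! Suc i \<noteq> r" using n(1) g lev_root by auto
  have "gpath (p ! Suc i) = take (Suc (Suc i)) p" using gpath_nth[OF x] i g by simp
  then have "par (p ! Suc i) = p ! i" using n(1) g by (simp add: par_def)
  then have "p ! Suc i = v" using i(2) inj_edge n(2) nr g assms by (auto simp: inj_on_def)
  then show "x \<in> below v" using x n g l by (auto simp: below_def)
next
  fix x assume "x \<in> below v"
  then have x: "x \<in> V" "lev v \<le> lev x" "gpath x ! lev v = v" by (auto simp: below_def)
  obtain n where n: "lev v = Suc n" using assms lev_par by blast
  have "gpath v = take (Suc (lev v)) (gpath x)" using gpath_nth[OF x(1), of "lev v"] x length_gpath by auto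
  then have "par v = gpath x ! n" using n by (simp add: par_def)
  then show "x \<in> vertices_through E r {par v, v}"
    using gpath[OF x(1)] x n length_gpath[OF x(1)]
    by (auto simp: vertices_through_def geodesic_def nonbacktracking_iff_nth intro!: exI[of _ "gpath x"] exI[of _ n])
qed

end

section \<open>Hitting probabilities of the root and capacity\<close>

context rooted_tree
begin

text \<open>\<open>Q m x\<close> is the probability that the walk from \<open>x\<close> hits the parent of \<open>x\<close> before
  descending \<open>m\<close> levels, computed by first-step analysis.\<close>

primrec Q :: "nat \<Rightarrow> 'v \<Rightarrow> real" where
  "Q 0 = (\<lambda>x. 0)"
| "Q (Suc m) = (\<lambda>x. 1 / (1 + (\<Sum>y\<in>ch x. 1 - Q m y)))"

lemma Q_bounds: "0 \<le> Q m x \<and> Q m x \<le> 1"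
proof (induction m arbitrary: x)
  case (Suc m)
  then have "0 \<le> (\<Sum>y\<in>ch x. 1 - Q m y)" by (intro sum_nonneg) simp
  then show ?case by simp
qed simp

lemma Q_mono: "Q m x \<le> Q (Suc m) x"
proof (induction m arbitrary: x)
  case 0
  show ?case using Q_bounds[of "Suc 0" x] by simp
next
  case (Suc m)
  have "0 \<le> (\<Sum>y\<in>ch x. 1 - Q (Suc m) y)" using Q_bounds by (intro sum_nonneg) (simp del: Q.simps)
  moreover have "(\<Sum>y\<in>ch x. 1 - Q (Suc m) y) \<le> (\<Sum>y\<in>ch x. 1 - Q m y)"
    using Suc by (intro sum_mono) (simp del: Q.simps)
  ultimately have "1 / (1 + (\<Sum>y\<in>ch x. 1 - Q m y)) \<le> 1 / (1 + (\<Sum>y\<in>ch x. 1 - Q (Suc m) y))"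
    by (intro divide_left_mono mult_pos_pos) linarith+
  then show ?case by (simp only: Q.simps)
qed

text \<open>For \<open>x \<noteq> r\<close> this stands for the probability that the walk from
  \<open>x\<close> ever reaches its parent. The arguments work with the fixed-point equation
  \<open>Qlim_eq\<close>.\<close>

definition Qlim :: "'v \<Rightarrow> real" where "Qlim x = lim (\<lambda>m. Q m x)"

lemma Q_tendsto: "(\<lambda>m. Q m x) \<longlonglongrightarrow> Qlim x"
proof -
  have "incseq (\<lambda>m. Q m x)" using Q_mono by (rule incseq_SucI)
  moreover have "\<forall>m. Q m x \<le> 1" using Q_bounds by simp
  ultimately obtain L where "(\<lambda>m. Q m x) \<longlonglongrightarrow> L"
    using incseq_convergent[of "\<lambda>m. Q m x" 1] by metis
  then show ?thesis unfolding Qlim_def by (simp add: limI)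
qed

lemma Qlim_le_1: "Qlim x \<le> 1"
  using Q_bounds by (intro LIMSEQ_le_const2[OF Q_tendsto]) auto

lemma Qlim_eq: "Qlim x = 1 / (1 + (\<Sum>y\<in>ch x. 1 - Qlim y))"
proof -
  have "0 \<le> (\<Sum>y\<in>ch x. 1 - Qlim y)" using Qlim_le_1 by (intro sum_nonneg) simp
  then have "(\<lambda>m. 1 / (1 + (\<Sum>y\<in>ch x. 1 - Q m y))) \<longlonglongrightarrow> 1 / (1 + (\<Sum>y\<in>ch x. 1 - Qlim y))"
    by (intro tendsto_intros Q_tendsto) linarith
  moreover have "(\<lambda>m. Q (Suc m) x) \<longlonglongrightarrow> Qlim x" by (rule LIMSEQ_Suc[OF Q_tendsto])
  ultimately show ?thesis by (simp add: LIMSEQ_unique)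
qed

lemma Qlim_pos: "0 < Qlim x"
proof -
  have "0 \<le> (\<Sum>y\<in>ch x. 1 - Qlim y)" using Qlim_le_1 by (intro sum_nonneg) simp
  then show ?thesis by (subst Qlim_eq) simp
qed

section \<open>Products along geodesics, flows and summation by parts\<close>

definition path_prod :: "('v \<Rightarrow> real) \<Rightarrow> 'v \<Rightarrow> real" where
  "path_prod q x = prod_list (map q (tl (gpath x)))"

definition drop_of :: "('v \<Rightarrow> real) \<Rightarrow> 'v \<Rightarrow> real" where
  "drop_of q x = path_prod q (par x) - path_prod q x"

lemma path_prod_root: "path_prod q r = 1"
  by (simp add: path_prod_def gpath_root)

lemma path_prod_child:
  assumes "y \<in> ch x" shows "path_prod q y = path_prod q x * q y"
  using childD[OF assms] gpath(4)[of x] by (cases "gpath x") (auto simp: path_prod_def)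

lemma drop_of_child:
  assumes "y \<in> ch x" shows "drop_of q y = path_prod q x * (1 - q y)"
  using path_prod_child[OF assms] childD(6)[OF assms] by (simp add: drop_of_def algebra_simps)

lemma sum_drop_of_ch: "(\<Sum>y\<in>ch x. drop_of q y) = path_prod q x * (\<Sum>y\<in>ch x. 1 - q y)"
  by (simp add: drop_of_child sum_distrib_left)

text \<open>The equation for \<open>q x\<close> says that \<open>q x\<close> times the sum of
  \<open>1 - q y\<close> over the children is \<open>1 - q x\<close>. Multiplied by the product at
  the parent, this is conservation of flow at \<open>x\<close>.\<close>

lemma drop_of_flow:
  assumes "x \<in> V" "x \<noteq> r" "q x = 1 / (1 + (\<Sum>y\<in>ch x. 1 - q y))" "\<And>y. q y \<le> 1"
  shows "(\<Sum>y\<in>ch x. drop_of q y) = drop_of q x"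
proof -
  let ?S = "\<Sum>y\<in>ch x. 1 - q y"
  have "0 \<le> ?S" using assms(4) by (intro sum_nonneg) simp
  then have "q x * ?S = 1 - q x" unfolding assms(3) by (simp add: field_simps)
  then show ?thesis
    using path_prod_child[OF child_par[OF assms(1,2)]] drop_of_child[OF child_par[OF assms(1,2)]]
    by (simp add: sum_drop_of_ch mult.assoc)
qed

text \<open>Summation by parts: in the terms of level \<open>k + 1\<close> containing
  \<open>path_prod q (par y)\<close>, the flow condition collects the siblings into the terms of
  level \<open>k\<close>, so the sum over the levels telescopes.\<close>

lemma flow_drop_of:
  assumes "\<And>x. x \<in> V \<Longrightarrow> x \<noteq> r \<Longrightarrow> lev x < N \<Longrightarrow> (\<Sum>y\<in>ch x. \<theta> y) = \<theta> x" "1 \<le> N"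
  shows "(\<Sum>k=1..N. \<Sum>x\<in>level k. \<theta> x * drop_of q x) =
    (\<Sum>x\<in>ch r. \<theta> x) - (\<Sum>x\<in>level N. \<theta> x * path_prod q x)"
  using assms(2,1)
proof (induction N rule: dec_induct)
  case base
  have "level 1 = ch r" by (simp add: level_Suc level_0)
  then show ?case
    using childD(6) by (simp add: drop_of_def path_prod_root right_diff_distrib sum_subtractf)
next
  case (step N)
  have "(\<Sum>y\<in>level (Suc N). \<theta> y * path_prod q (par y)) = (\<Sum>x\<in>level N. \<Sum>y\<in>ch x. \<theta> y * path_prod q x)"
    unfolding sum_level_Suc using childD(6) by (intro sum.cong refl) simp
  also have "\<dots> = (\<Sum>x\<in>level N. \<theta> x * path_prod q x)"
  proof (intro sum.cong refl)
    fix x assume x: "x \<in> level N"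
    then have "x \<noteq> r" using step.hyps lev_root by (auto simp: level_def)
    then have "(\<Sum>y\<in>ch x. \<theta> y) = \<theta> x" using x step.prems by (auto simp: level_def)
    then show "(\<Sum>y\<in>ch x. \<theta> y * path_prod q x) = \<theta> x * path_prod q x"
      by (simp flip: sum_distrib_right)
  qed
  finally show ?case
    using step by (simp add: drop_of_def right_diff_distrib sum_subtractf)
qed

text \<open>\<open>n - lev x\<close> is the number of levels left before level \<open>n\<close>; by
  truncated subtraction \<open>qn n\<close> vanishes from level \<open>n\<close> on.\<close>

definition qn :: "nat \<Rightarrow> 'v \<Rightarrow> real" where "qn n x = Q (n - lev x) x"

text \<open>These are \<open>h\<close> and \<open>h\<^sub>n\<close> of the overview: to reach the
  root the walk has to reach all ancestors in turn, so by the strong Markov property the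
  probabilities multiply along the geodesic.\<close>

abbreviation hit :: "'v \<Rightarrow> real" where "hit \<equiv> path_prod Qlim"
abbreviation hitn :: "nat \<Rightarrow> 'v \<Rightarrow> real" where "hitn n \<equiv> path_prod (qn n)"

lemma qn_eq:
  assumes "lev x < n" shows "qn n x = 1 / (1 + (\<Sum>y\<in>ch x. 1 - qn n y))"
proof -
  obtain m where m: "n - lev x = Suc m" using assms by (metis Suc_diff_Suc)
  have "Q m y = qn n y" if "y \<in> ch x" for y
    using childD(5)[OF that] m by (simp add: qn_def Suc_diff_Suc[symmetric] diff_Suc)
  then show ?thesis using m by (simp add: qn_def)
qed

lemma hit_pos: "0 < hit x"
proof -
  have "0 < prod_list (map Qlim xs)" for xs by (induction xs) (simp_all add: Qlim_pos)
  then show ?thesis by (simp add: path_prod_def)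
qed

lemma hit_child_le: "y \<in> ch x \<Longrightarrow> hit y \<le> hit x"
  using Qlim_le_1[of y] hit_pos[of x] by (simp add: path_prod_child mult_left_le)

text \<open>The last factor \<open>qn n x\<close> vanishes; \<open>1 \<le> n\<close> keeps
  \<open>x\<close> away from the root, where the empty product is 1.\<close>

lemma hitn_eq_0:
  assumes "x \<in> V" "n \<le> lev x" "1 \<le> n" shows "hitn n x = 0"
proof -
  have "x \<noteq> r" using assms lev_root by auto
  moreover have "qn n x = 0" using assms by (simp add: qn_def)
  ultimately show ?thesis using path_prod_child[OF child_par[OF assms(1)]] by simp
qed

lemma drop_of_hit_flow: "x \<in> V \<Longrightarrow> x \<noteq> r \<Longrightarrow> (\<Sum>y\<in>ch x. drop_of Qlim y) = drop_of Qlim x"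
  using Qlim_le_1 by (intro drop_of_flow Qlim_eq)

lemma drop_of_hitn_flow:
  "x \<in> V \<Longrightarrow> x \<noteq> r \<Longrightarrow> lev x < n \<Longrightarrow> (\<Sum>y\<in>ch x. drop_of (qn n) y) = drop_of (qn n) x"
  using Q_bounds by (intro drop_of_flow qn_eq) (auto simp: qn_def)

lemma drop_of_hitn_eq_0:
  assumes "x \<in> V" "n < lev x" "1 \<le> n" shows "drop_of (qn n) x = 0"
proof -
  have "x \<noteq> r" using assms lev_root by auto
  then show ?thesis using assms hitn_eq_0[of x n] hitn_eq_0[of "par x" n] lev_par[of x] par_in[of x]
    by (simp add: drop_of_def)
qed

text \<open>This is \<open>f\<^sub>n(\<omega>) - f(\<omega>)\<close>: the root has exactly one
  child, and summing over \<open>ch r\<close> avoids naming it.\<close>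

definition gap :: "nat \<Rightarrow> real" where
  "gap n = (\<Sum>x\<in>ch r. drop_of (qn n) x) - (\<Sum>x\<in>ch r. drop_of Qlim x)"

text \<open>Expand the square of \<open>?g - ?f\<close>. By \<open>flow_drop_of\<close> the pairing
  of \<open>?g\<close> with itself is its sum over \<open>ch r\<close>, the mixed pairing is that of
  \<open>?f\<close>, and the pairing of \<open>?f\<close> with itself is at most that of
  \<open>?f\<close>.\<close>

lemma energy_levels:
  assumes "1 \<le> n" "n \<le> N"
  shows "(\<Sum>k=1..N. \<Sum>x\<in>level k. (drop_of (qn n) x - drop_of Qlim x)\<^sup>2) \<le> gap n"
proof -
  let ?f = "drop_of Qlim" and ?g = "drop_of (qn n)"
  \<comment> \<open>Level \<open>n\<close> is also where the flow property of \<open>?g\<close>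
    ends, so all pairings with \<open>?g\<close> are evaluated there.\<close>
  have cut: "(\<Sum>k=1..N. \<Sum>x\<in>level k. ?g x * F x) = (\<Sum>k=1..n. \<Sum>x\<in>level k. ?g x * F x)" for F
    using assms drop_of_hitn_eq_0
    by (intro sum.mono_neutral_right) (auto simp: level_def intro!: sum.neutral)
  have 0: "(\<Sum>x\<in>level n. \<theta> x * hitn n x) = 0" for \<theta>
    using hitn_eq_0 assms by (intro sum.neutral) (auto simp: level_def)
  have gg: "(\<Sum>k=1..n. \<Sum>x\<in>level k. ?g x * ?g x) = (\<Sum>x\<in>ch r. ?g x)"
    using flow_drop_of[of n ?g "qn n"] drop_of_hitn_flow assms by (simp add: 0)
  \<comment> \<open>Here \<open>?f\<close> is taken as the flow and \<open>hitn n\<close> as the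
    potential, so that the remaining term at level \<open>n\<close> vanishes.\<close>
  have "(\<Sum>k=1..n. \<Sum>x\<in>level k. ?f x * ?g x) = (\<Sum>x\<in>ch r. ?f x)"
    using flow_drop_of[of n ?f "qn n"] drop_of_hit_flow assms by (simp add: 0)
  then have fg: "(\<Sum>k=1..n. \<Sum>x\<in>level k. ?g x * ?f x) = (\<Sum>x\<in>ch r. ?f x)"
    by (simp add: mult.commute)
  have fpos: "0 \<le> ?f x" if "x \<in> level N" for x
  proof -
    have "x \<in> V" "x \<noteq> r" using that assms lev_root by (auto simp: level_def)
    then show ?thesis using hit_child_le[OF child_par[of x]] by (simp add: drop_of_def)
  qed
  \<comment> \<open>With the potential \<open>hit\<close> the term at level \<open>N\<close> need
    not vanish; its sign gives the inequality.\<close>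
  have "0 \<le> (\<Sum>x\<in>level N. ?f x * hit x)"
    using fpos hit_pos by (intro sum_nonneg mult_nonneg_nonneg) (auto simp: less_imp_le)
  then have ff: "(\<Sum>k=1..N. \<Sum>x\<in>level k. ?f x * ?f x) \<le> (\<Sum>x\<in>ch r. ?f x)"
    using flow_drop_of[of N ?f Qlim] drop_of_hit_flow assms by simp
  have "(\<Sum>k=1..N. \<Sum>x\<in>level k. (?g x - ?f x)\<^sup>2) =
     (\<Sum>k=1..N. \<Sum>x\<in>level k. ?g x * ?g x) - 2 * (\<Sum>k=1..N. \<Sum>x\<in>level k. ?g x * ?f x)
       + (\<Sum>k=1..N. \<Sum>x\<in>level k. ?f x * ?f x)"
    by (simp add: power2_eq_square algebra_simps sum.distrib sum_subtractf sum_distrib_left)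
  also have "\<dots> \<le> gap n"
    using ff unfolding cut gg fg gap_def by simp
  finally show ?thesis .
qed

lemma energy_finite:
  assumes "1 \<le> n" "finite S" "S \<subseteq> V - {r}"
  shows "(\<Sum>x\<in>S. (drop_of (qn n) x - drop_of Qlim x)\<^sup>2) \<le> gap n"
proof -
  define N where "N = Max (insert n (lev ` S))"
  have N: "n \<le> N" "\<And>x. x \<in> S \<Longrightarrow> lev x \<le> N" using assms(2) by (auto simp: N_def)
  have "S \<subseteq> (\<Union>k\<in>{1..N}. level k)"
  proof
    fix x assume x: "x \<in> S"
    then have "lev x \<noteq> 0" using assms lev_eq_0 by auto
    then show "x \<in> (\<Union>k\<in>{1..N}. level k)" using x assms N(2) by (auto simp: level_def Suc_le_eq)
  qed
  then have "(\<Sum>x\<in>S. (drop_of (qn n) x - drop_of Qlim x)\<^sup>2)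
      \<le> (\<Sum>x\<in>(\<Union>k\<in>{1..N}. level k). (drop_of (qn n) x - drop_of Qlim x)\<^sup>2)"
    by (intro sum_mono2) (auto simp: finite_level)
  also have "\<dots> = (\<Sum>k=1..N. \<Sum>x\<in>level k. (drop_of (qn n) x - drop_of Qlim x)\<^sup>2)"
    using finite_level by (intro sum.UNION_disjoint) (auto simp: level_def)
  also have "\<dots> \<le> gap n" by (rule energy_levels[OF assms(1) N(1)])
  finally show ?thesis .
qed

text \<open>Children of the root have level 1, so the difference of the flows is
  \<open>Qlim x - Q (n - 1) x\<close> there.\<close>

lemma gap_tendsto_0: "gap \<longlonglongrightarrow> 0"
proof -
  have "gap = (\<lambda>n. \<Sum>x\<in>ch r. Qlim x - Q (n - 1) x)"
    unfolding gap_def[abs_def] using childD(5) lev_root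
    by (simp add: drop_of_child path_prod_root qn_def sum_subtractf)
  moreover have "(\<lambda>n. Q (n - 1) x) \<longlonglongrightarrow> Qlim x" for x
    by (rule LIMSEQ_offset[of _ 1]) (simp add: Q_tendsto)
  then have "(\<lambda>n. \<Sum>x\<in>ch r. Qlim x - Q (n - 1) x) \<longlonglongrightarrow> (\<Sum>x\<in>ch r. Qlim x - Qlim x)"
    by (intro tendsto_intros)
  ultimately show ?thesis by simp
qed

text \<open>The sum telescopes; \<open>hit\<close> and \<open>hitn n\<close> agree at the root, and
  \<open>hitn n\<close> is 0 at level \<open>N\<close>. The result does not depend on
  \<open>n\<close>, so every truncation contributes equally to the potential.\<close>

lemma ray_sum:
  assumes "\<zeta> \<in> tree_boundary E \<omega> r" "1 \<le> n" "n \<le> N"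
  shows "(\<Sum>j<N. drop_of (qn n) (\<zeta> (Suc j)) - drop_of Qlim (\<zeta> (Suc j))) = hit (\<zeta> N)"
proof -
  have "par (\<zeta> (Suc j)) = \<zeta> j" for j using assms(1) childD(6) by (simp add: boundary_iff)
  then have "(\<Sum>j<N. drop_of (qn n) (\<zeta> (Suc j)) - drop_of Qlim (\<zeta> (Suc j))) =
      (\<Sum>j<N. (hit (\<zeta> (Suc j)) - hitn n (\<zeta> (Suc j))) - (hit (\<zeta> j) - hitn n (\<zeta> j)))"
    by (simp add: drop_of_def algebra_simps)
  also have "\<dots> = (hit (\<zeta> N) - hitn n (\<zeta> N)) - (hit (\<zeta> 0) - hitn n (\<zeta> 0))"
    by (rule sum_lessThan_telescope)
  also have "\<dots> = hit (\<zeta> N)"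
    using assms boundary_gpath[OF assms(1)] by (simp add: hitn_eq_0 boundary_iff path_prod_root)
  finally show ?thesis .
qed

text \<open>For a sparse choice of levels \<open>m k\<close>, Minkowski's inequality keeps the norm
  of the sum of the \<open>b k\<close> small, whereas by \<open>ray_sum\<close> each
  \<open>b k\<close> adds at least \<open>l\<close> to the potential along \<zeta>.\<close>

lemma capacity_eq_0:
  assumes A: "\<And>\<zeta>. \<zeta> \<in> A \<Longrightarrow> \<zeta> \<in> tree_boundary E \<omega> r \<and> (\<exists>l>0. \<forall>j. l \<le> hit (\<zeta> j))"
  shows "capacity E A = 0"
proof -
  have "capacity E A \<le> ennreal \<epsilon>" if \<epsilon>: "0 < \<epsilon>" for \<epsilon> :: real
  proof -
    define \<eta> where "\<eta> = sqrt \<epsilon>"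
    have \<eta>: "0 < \<eta>" "\<eta>\<^sup>2 = \<epsilon>" using \<epsilon> by (auto simp: \<eta>_def)
    \<comment> \<open>The resulting norms \<open>\<eta> / 2 ^ Suc k\<close> add up to \<eta>, which
      makes the energy at most \<open>\<eta>\<^sup>2 = \<epsilon>\<close>.\<close>
    have "\<exists>n\<ge>1. gap n \<le> (\<eta> / 2 ^ Suc k)\<^sup>2" for k
    proof -
      have "0 < (\<eta> / 2 ^ Suc k)\<^sup>2" using \<eta> by simp
      then have "eventually (\<lambda>n. gap n < (\<eta> / 2 ^ Suc k)\<^sup>2) sequentially"
        using gap_tendsto_0 by (rule order_tendstoD(2)[rotated])
      then have "eventually (\<lambda>n. 1 \<le> n \<and> gap n < (\<eta> / 2 ^ Suc k)\<^sup>2) sequentially"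
        using eventually_ge_at_top[of 1] by eventually_elim simp
      then show ?thesis by (auto simp: eventually_sequentially intro: less_imp_le)
    qed
    then obtain m where m: "\<And>k. 1 \<le> m k" "\<And>k. gap (m k) \<le> (\<eta> / 2 ^ Suc k)\<^sup>2" by metis
    define b where "b k x = \<bar>drop_of (qn (m k)) x - drop_of Qlim x\<bar>" for k x
    have b0: "0 \<le> b k x" for k x by (simp add: b_def)
    have bL2: "L2_set (b k) S \<le> \<eta> / 2 ^ Suc k" if "finite S" "S \<subseteq> V - {r}" for k S
    proof -
      have "(\<Sum>x\<in>S. (b k x)\<^sup>2) \<le> (\<eta> / 2 ^ Suc k)\<^sup>2"
        using energy_finite[OF m(1) that, of k] m(2)[of k] by (simp add: b_def)
      then show ?thesis unfolding L2_set_def using \<eta> by (intro real_le_lsqrt) (auto simp: sum_nonneg)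
    qed
    \<comment> \<open>Singletons turn the norm bound into a pointwise one, under which the series
      defining \<open>g\<close> converges.\<close>
    have b_le: "b k x \<le> \<eta> / 2 ^ Suc k" if "x \<in> V - {r}" for k x
      using bL2[of "{x}" k] that b0[of k x] by simp
    have geo: "(\<lambda>k. \<eta> / 2 ^ Suc k) sums \<eta>"
      using sums_mult[OF power_half_series, of \<eta>] by (simp add: power_divide)
    have summ: "summable (\<lambda>k. b k x)" if "x \<in> V - {r}" for x
      using b_le[OF that] b0 by (intro summable_comparison_test'[OF sums_summable[OF geo]]) auto
    define g where "g x = (\<Sum>k. b k x)" for x
    have g0: "0 \<le> g x" if "x \<in> V - {r}" for x
      unfolding g_def using summ[OF that] b0 by (intro suminf_nonneg)
    have g_ge: "(\<Sum>k<K. b k x) \<le> g x" if "x \<in> V - {r}" for x K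
      unfolding g_def using summ[OF that] b0 by (intro sum_le_suminf) auto
    have gS: "(\<Sum>x\<in>S. (g x)\<^sup>2) \<le> \<epsilon>" if S: "finite S" "S \<subseteq> V - {r}" for S
    proof -
      \<comment> \<open>Minkowski's inequality for the partial sums.\<close>
      have L: "L2_set (\<lambda>x. \<Sum>k<K. b k x) S \<le> (\<Sum>k<K. \<eta> / 2 ^ Suc k)" for K
      proof (induction K)
        case (Suc K)
        have "L2_set (\<lambda>x. \<Sum>k<Suc K. b k x) S \<le> L2_set (\<lambda>x. \<Sum>k<K. b k x) S + L2_set (b K) S"
          using L2_set_triangle_ineq[of "\<lambda>x. \<Sum>k<K. b k x" "b K" S] by simp
        also have "\<dots> \<le> (\<Sum>k<K. \<eta> / 2 ^ Suc k) + \<eta> / 2 ^ Suc K"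
          using Suc bL2[OF S] by (rule add_mono)
        finally show ?case by simp
      qed (simp add: L2_set_def)
      have part: "(\<Sum>x\<in>S. (\<Sum>k<K. b k x)\<^sup>2) \<le> \<epsilon>" for K
      proof -
        have "(\<Sum>k<K. \<eta> / 2 ^ Suc k) \<le> \<eta>"
          using sum_le_suminf[OF sums_summable[OF geo], of "{..<K}"] sums_unique[OF geo] \<eta> by simp
        then have "L2_set (\<lambda>x. \<Sum>k<K. b k x) S \<le> \<eta>" using L[of K] by linarith
        then have "(L2_set (\<lambda>x. \<Sum>k<K. b k x) S)\<^sup>2 \<le> \<eta>\<^sup>2"
          by (intro power_mono) (auto simp: L2_set_nonneg)
        then show ?thesis using \<eta> by (simp add: L2_set_def sum_nonneg)
      qed
      \<comment> \<open>Since \<open>S\<close> is finite, the bound passes to the limit in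
        \<open>K\<close> term by term.\<close>
      have "(\<lambda>K. \<Sum>x\<in>S. (\<Sum>k<K. b k x)\<^sup>2) \<longlonglongrightarrow> (\<Sum>x\<in>S. (g x)\<^sup>2)"
        unfolding g_def using summ S by (intro tendsto_intros summable_LIMSEQ) auto
      then show ?thesis using part by (intro LIMSEQ_le_const2) auto
    qed
    let ?e = "\<lambda>x. {par x, x}"
    \<comment> \<open>\<open>g\<close> lives on lower endpoints; \<open>f\<close> carries it over to
      the edges.\<close>
    define f where "f \<alpha> = g (inv_into (V - {r}) ?e \<alpha>)" for \<alpha>
    have fe: "f (?e x) = g x" if "x \<in> V - {r}" for x
      unfolding f_def using inv_into_f_f[OF inj_edge that] by simp
    have f_nonneg: "\<forall>\<alpha>\<in>E. 0 \<le> f \<alpha>" using g0 fe by (subst E_eq) auto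
    have f_pot: "1 \<le> edge_potential f \<zeta>" if \<zeta>: "\<zeta> \<in> A" for \<zeta>
    proof -
      obtain l where l: "0 < l" "\<And>j. l \<le> hit (\<zeta> j)" and bd: "\<zeta> \<in> tree_boundary E \<omega> r"
        using A[OF \<zeta>] by blast
      have zr: "\<zeta> (Suc j) \<in> V - {r}" and edge: "{\<zeta> j, \<zeta> (Suc j)} = ?e (\<zeta> (Suc j))" for j
        using bd childD(3,6,7)[of "\<zeta> (Suc j)" "\<zeta> j"] by (auto simp: boundary_iff)
      have injz: "inj (\<lambda>j. \<zeta> (Suc j))"
        by (rule injI) (metis boundary_gpath(2)[OF bd] Suc_inject)
      obtain K :: nat where K: "1 \<le> K * l"
        using reals_Archimedean3[OF l(1)] by (metis less_imp_le)
      \<comment> \<open>\<open>N\<close> dominates \<open>m k\<close> for all \<open>k < K\<close>,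
        so that \<open>ray_sum\<close> applies to all of them with the same segment of \<zeta>; the
        inserted 1 makes the set nonempty.\<close>
      define N where "N = Max (insert 1 (m ` {..<K}))"
      have N: "m k \<le> N" if "k < K" for k using that by (auto simp: N_def)
      have "1 \<le> (\<Sum>k<K. l)" using K by simp
      also have "\<dots> \<le> (\<Sum>k<K. \<Sum>j<N. b k (\<zeta> (Suc j)))"
      proof (intro sum_mono)
        fix k assume "k \<in> {..<K}"
        then have "hit (\<zeta> N) = (\<Sum>j<N. drop_of (qn (m k)) (\<zeta> (Suc j)) - drop_of Qlim (\<zeta> (Suc j)))"
          using ray_sum[OF bd m(1) N] by simp
        also have "\<dots> \<le> (\<Sum>j<N. b k (\<zeta> (Suc j)))" unfolding b_def by (intro sum_mono) simp
        finally show "l \<le> (\<Sum>j<N. b k (\<zeta> (Suc j)))" using l(2)[of N] by linarith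
      qed
      also have "\<dots> = (\<Sum>j<N. \<Sum>k<K. b k (\<zeta> (Suc j)))" by (rule sum.swap)
      also have "\<dots> \<le> (\<Sum>j<N. g (\<zeta> (Suc j)))" using g_ge zr by (intro sum_mono) auto
      finally have "ennreal 1 \<le> ennreal (\<Sum>j<N. g (\<zeta> (Suc j)))" by (rule ennreal_leI)
      also have "\<dots> = (\<Sum>j<N. ennreal (f (?e (\<zeta> (Suc j)))))"
        using g0[OF zr] fe[OF zr] by (simp add: sum_ennreal)
      also have "\<dots> = (\<Sum>\<alpha>\<in>(\<lambda>j. ?e (\<zeta> (Suc j))) ` {..<N}. ennreal (f \<alpha>))"
      proof (subst sum.reindex)
        have "inj_on (?e \<circ> (\<lambda>j. \<zeta> (Suc j))) UNIV"
          using injz zr by (intro comp_inj_on inj_on_subset[OF inj_edge]) auto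
        then show "inj_on (\<lambda>j. ?e (\<zeta> (Suc j))) {..<N}" by (auto simp: inj_on_def o_def)
      qed simp
      also have "\<dots> \<le> edge_potential f \<zeta>"
        unfolding edge_potential_def
        by (subst nonneg_infsum_complete)
          (auto intro!: SUP_upper simp: geodesic_edges_def edge[symmetric])
      finally show ?thesis by simp
    qed
    have "capacity E A \<le> (\<Sum>\<^sub>\<infinity>\<alpha>\<in>E. ennreal ((f \<alpha>)\<^sup>2))"
      unfolding capacity_def using f_nonneg f_pot by (intro INF_lower) auto
    also have "\<dots> = (\<Sum>\<^sub>\<infinity>\<alpha>\<in>?e ` (V - {r}). ennreal ((f \<alpha>)\<^sup>2))"
      by (rule arg_cong[OF E_eq])
    also have "\<dots> = (\<Sum>\<^sub>\<infinity>x\<in>V - {r}. ennreal ((f (?e x))\<^sup>2))"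
      by (simp add: infsum_reindex[OF inj_edge] o_def)
    also have "\<dots> = (\<Sum>\<^sub>\<infinity>x\<in>V - {r}. ennreal ((g x)\<^sup>2))"
      using fe by (intro infsum_cong) metis
    also have "\<dots> \<le> ennreal \<epsilon>"
    proof (rule infsum_le_finite_sums)
      fix S assume S: "finite S" "S \<subseteq> V - {r}"
      have "(\<Sum>x\<in>S. ennreal ((g x)\<^sup>2)) = ennreal (\<Sum>x\<in>S. (g x)\<^sup>2)" by (simp add: sum_ennreal)
      then show "(\<Sum>x\<in>S. ennreal ((g x)\<^sup>2)) \<le> ennreal \<epsilon>" using gS[OF S] by (simp add: ennreal_leI)
    qed (simp add: nonneg_summable_on_complete)
    finally show ?thesis .
  qed
  then have "capacity E A \<le> 0 + ennreal e" if "0 < e" for e using that by simp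
  then have "capacity E A \<le> 0"
    by (rule ennreal_le_epsilon) simp
  then show ?thesis by simp
qed

end

section \<open>One-step analysis of the random walk\<close>

lemma sets_walk_law [measurable_cong]:
  "sets (walk_law E r x) = sets (PiM UNIV (\<lambda>_. count_space UNIV))"
  by (simp add: walk_law_def)

lemma space_walk_law [simp]: "space (walk_law E r x) = UNIV"
  by (simp add: walk_law_def space_PiM)

text \<open>A measure with a probability measure as image is itself one; the projection to the empty
  set of coordinates has a known image.\<close>

lemma prob_space_walk_law: "prob_space (walk_law E r x)"
proof (rule prob_space_distrD)
  show "(\<lambda>z. restrict z {}) \<in> measurable (walk_law E r x) (PiM {} (\<lambda>_. count_space UNIV))"
    by measurable
  show "prob_space (distr (walk_law E r x) (PiM {} (\<lambda>_. count_space UNIV)) (\<lambda>z. restrict z {}))"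
    using walk.distr_lim[of "{}" E r x] walk.PF.prob_space_P[of "{}" E r x]
    by (simp add: walk_law_def)
qed

lemma walk_coordinate [measurable]: "(\<lambda>z. z n) \<in> measurable (walk_law E r x) (count_space UNIV)"
  unfolding measurable_cong_sets[OF sets_walk_law refl] by (rule measurable_component_singleton) simp

lemma walk_coordinate_fun:
  fixes h :: "'v \<Rightarrow> ennreal"
  shows "(\<lambda>z. h (z n)) \<in> borel_measurable (walk_law E r x)"
  by (rule measurable_compose[OF walk_coordinate]) simp

lemma walk_coordinate_in: "{z. z n \<in> A} \<in> sets (walk_law E r x)"
  using measurable_sets[OF walk_coordinate, of A n E r x] by (simp add: vimage_def)

text \<open>Reduces integrals over finitely many coordinates to \<open>walk.C\<close>, whose
  recursion exposes the last transition kernel.\<close>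

lemma walk_law_restrict:
  "distr (walk_law E r x) (PiM {0..<n} (\<lambda>_. count_space UNIV)) (\<lambda>z. restrict z {0..<n}) =
     walk.C E r x 0 n (\<lambda>_. undefined)"
proof -
  have "distr (walk_law E r x) (PiM {0..<n} (\<lambda>_. count_space UNIV)) (\<lambda>z. restrict z {0..<n}) =
      walk.CI E r x {0..<n}"
    unfolding walk_law_def by (rule walk.distr_lim) simp
  also have "\<dots> = walk.C E r x 0 n (\<lambda>_. undefined)"
  proof (rule measure_eqI)
    fix X assume "X \<in> sets (walk.CI E r x {0..<n})"
    then have X: "X \<in> sets (PiM {0..<n} (\<lambda>_. count_space UNIV))" by (simp add: walk.PF.sets_P)
    have "prod_emb {0..<n} (\<lambda>_. count_space UNIV) {0..<n} X = X"
      using sets.sets_into_space[OF X] by (intro prod_emb_id) (simp add: space_PiM)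
    then show "emeasure (walk.CI E r x {0..<n}) X = emeasure (walk.C E r x 0 n (\<lambda>_. undefined)) X"
      using walk.emeasure_CI[OF subset_refl X, of E r x] by simp
  next
    show "sets (walk.CI E r x {0..<n}) = sets (walk.C E r x 0 n (\<lambda>_. undefined))"
      by (subst walk.sets_C) (simp_all add: walk.PF.sets_P space_PiM)
  qed
  finally show ?thesis .
qed

lemma walk_nn_integral_restrict:
  assumes "f \<in> borel_measurable (PiM {0..<n} (\<lambda>_. count_space UNIV))"
  shows "(\<integral>\<^sup>+z. f (restrict z {0..<n}) \<partial>walk_law E r x) = (\<integral>\<^sup>+z. f z \<partial>walk.C E r x 0 n (\<lambda>_. undefined))"
  unfolding walk_law_restrict[symmetric]
  by (rule nn_integral_distr[symmetric]) (use assms in measurable)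

text \<open>The Markov property at time \<open>n\<close>: in the law of the coordinates
  \<open>0..n + 1\<close> the last kernel is integrated out first.\<close>

lemma walk_transition:
  fixes u :: "'v \<Rightarrow> ennreal"
  shows "(\<integral>\<^sup>+z. indicator A (z n) * u (z (Suc n)) \<partial>walk_law E r x) =
    (\<integral>\<^sup>+z. indicator A (z n) * (\<integral>\<^sup>+y. u y \<partial>measure_pmf (walk_step E r (z n))) \<partial>walk_law E r x)"
proof -
  let ?M = "\<lambda>_::nat. count_space (UNIV :: 'v set)"
  let ?u = "\<lambda>_::nat. undefined :: 'v"
  let ?s = "\<lambda>a. \<integral>\<^sup>+y. u y \<partial>measure_pmf (walk_step E r a)"
  let ?f = "\<lambda>z. indicator A (z n) * u (z (Suc n)) :: ennreal"
  let ?g = "\<lambda>z. indicator A (z n) * ?s (z n) :: ennreal"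
  have u0: "?u \<in> space (PiM {0..<0} ?M)" by (simp add: space_PiM)
  have cn: "(\<lambda>z. h (z k)) \<in> borel_measurable (PiM {0..<m} ?M)" if "k < m" for h :: "'v \<Rightarrow> ennreal" and k m
    by (rule measurable_compose[OF measurable_component_singleton]) (use that in auto)
  have mf: "?f \<in> borel_measurable (PiM {0..<Suc (Suc n)} ?M)"
    by (intro borel_measurable_times_ennreal cn) auto
  have mg: "?g \<in> borel_measurable (PiM {0..<Suc n} ?M)"
    by (intro borel_measurable_times_ennreal cn) auto
  have "(\<integral>\<^sup>+z. ?f z \<partial>walk_law E r x) = (\<integral>\<^sup>+z. ?f z \<partial>walk.C E r x 0 (Suc (Suc n)) ?u)"
    using walk_nn_integral_restrict[OF mf, of E r x] by simp
  also have "\<dots> = (\<integral>\<^sup>+z. \<integral>\<^sup>+w. ?f w \<partial>walk.eP E r x (Suc n) z \<partial>walk.C E r x 0 (Suc n) ?u)"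
  proof -
    have "walk.eP E r x (Suc n) \<in> measurable (walk.C E r x 0 (Suc n) ?u) (subprob_algebra (PiM {0..<Suc (Suc n)} ?M))"
      unfolding measurable_cong_sets[OF walk.sets_C[OF u0] refl] add_0 by (rule walk.measurable_eP)
    then show ?thesis
      using nn_integral_bind[OF mf] by (subst walk.C.simps) (simp del: walk.C.simps)
  qed
  also have "\<dots> = (\<integral>\<^sup>+z. ?g z \<partial>walk.C E r x 0 (Suc n) ?u)"
  proof (rule nn_integral_cong)
    fix z assume "z \<in> space (walk.C E r x 0 (Suc n) ?u)"
    then have z: "z \<in> space (PiM {0..<Suc n} ?M)" using walk.space_C[OF u0, of E r x "Suc n"] by (simp del: walk.C.simps)
    show "(\<integral>\<^sup>+w. ?f w \<partial>walk.eP E r x (Suc n) z) = ?g z"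
      by (subst walk.nn_integral_eP[OF z mf]) (simp add: walk_kernel_def nn_integral_cmult)
  qed
  also have "\<dots> = (\<integral>\<^sup>+z. ?g z \<partial>walk_law E r x)"
    using walk_nn_integral_restrict[OF mg, of E r x] by simp
  finally show ?thesis .
qed

lemma walk_start: "AE z in walk_law E r x. z 0 = x"
proof -
  interpret prob_space "walk_law E r x" by (rule prob_space_walk_law)
  have "emeasure (walk_law E r x) {z. z 0 = x} = 1"
    using walk_law_cylinder[of E r x 0 "\<lambda>_. x"] by simp
  then have "prob {z. z 0 = x} = 1" by (simp add: measure_def)
  from AE_prob_1[OF this] show ?thesis by simp
qed

context rooted_tree
begin

text \<open>By \<open>walk_transition\<close> a forbidden step from a fixed vertex at a fixed time
  has probability 0; countability of \<open>V\<close> allows all these null sets to be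
  combined.\<close>

lemma walk_AE_path:
  assumes "x \<in> V"
  shows "AE z in walk_law E r x. z 0 = x \<and> (\<forall>n. z n \<in> V \<and>
    (if z n = r then z (Suc n) = r else adj (z n) (z (Suc n))))"
proof -
  let ?W = "walk_law E r x"
  let ?ok = "\<lambda>a b. if a = r then b = r else adj a b"
  have step: "AE z in ?W. z n = a \<longrightarrow> ?ok a (z (Suc n))" if "a \<in> V" for n a
  proof -
    have "(\<integral>\<^sup>+z. indicator {a} (z n) * indicator {b. \<not> ?ok a b} (z (Suc n)) \<partial>?W) =
      (\<integral>\<^sup>+z. indicator {a} (z n) * emeasure (measure_pmf (walk_step E r (z n))) {b. \<not> ?ok a b} \<partial>?W)"
      using walk_transition[where A="{a}" and n=n and u="indicator {b. \<not> ?ok a b}" and E=E and r=r and x=x] by simp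
    also have "\<dots> = (\<integral>\<^sup>+z. 0 \<partial>?W)"
    proof (rule nn_integral_cong)
      fix z
      have "emeasure (measure_pmf (walk_step E r a)) {b. \<not> ?ok a b} = 0"
      proof (cases "a = r")
        case True then show ?thesis by (simp add: walk_step_def)
      next
        case False
        have ne: "neighbours E a \<noteq> {}" using neighbours_eq[OF that False] by simp
        have "set_pmf (walk_step E r a) = neighbours E a"
          using False set_pmf_of_set[OF ne locally_finite[OF that]] by (simp add: walk_step_def)
        then show ?thesis using False
          by (subst emeasure_Int_set_pmf[symmetric]) (auto simp: neighbours_def Int_def)
      qed
      then show "indicator {a} (z n) * emeasure (measure_pmf (walk_step E r (z n))) {b. \<not> ?ok a b} = 0"
        by (cases "z n = a") (simp_all split del: if_split)
    qed
    finally have "(\<integral>\<^sup>+z. indicator {a} (z n) * indicator {b. \<not> ?ok a b} (z (Suc n)) \<partial>?W) = 0" by simp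
    then have "AE z in ?W. indicator {a} (z n) * indicator {b. \<not> ?ok a b} (z (Suc n)) = (0::ennreal)"
      by (subst (asm) nn_integral_0_iff_AE) (auto intro!: borel_measurable_times_ennreal walk_coordinate_fun)
    then show ?thesis by eventually_elim (auto split: split_indicator_asm if_splits)
  qed
  have "AE z in ?W. \<forall>n. \<forall>a\<in>V. z n = a \<longrightarrow> ?ok a (z (Suc n))"
    unfolding AE_all_countable using step countable_V by (intro allI AE_ball_countable') auto
  with walk_start show ?thesis
  proof eventually_elim
    case (elim z)
    have "z n \<in> V" for n
    proof (induction n)
      case (Suc n)
      then have "?ok (z n) (z (Suc n))" using elim by blast
      then show ?case using root_vertex adj_vertices(2) by (auto split: if_splits)
    qed (use elim assms in simp)
    then show ?case using elim by auto
  qed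
qed

text \<open>The one-step inequality is iterated along the walk, each visit to \<open>v\<close>
  costing \<open>c\<close>. For \<open>c = 0\<close> this is the supermartingale inequality; for
  positive \<open>c\<close> it bounds the expected number of visits to \<open>v\<close>.\<close>

lemma superharmonic_bound:
  fixes u :: "'v \<Rightarrow> ennreal"
  assumes "x \<in> V"
    and u: "\<And>a. a \<in> V \<Longrightarrow> (\<integral>\<^sup>+b. u b \<partial>measure_pmf (walk_step E r a)) + c * indicator {v} a \<le> u a"
  shows "(\<Sum>i<N. c * emeasure (walk_law E r x) {z. z i = v}) + (\<integral>\<^sup>+z. u (z N) \<partial>walk_law E r x) \<le> u x"
proof (induction N)
  case 0
  interpret prob_space "walk_law E r x" by (rule prob_space_walk_law)
  have "(\<integral>\<^sup>+z. u (z 0) \<partial>walk_law E r x) = (\<integral>\<^sup>+z. u x \<partial>walk_law E r x)"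
    by (rule nn_integral_cong_AE, rule eventually_mono[OF walk_start]) simp
  then show ?case using emeasure_space_1 by simp
next
  case (Suc N)
  let ?W = "walk_law E r x"
  have [measurable]: "{z. z N = v} \<in> sets ?W" "(\<lambda>z. h (z N)) \<in> borel_measurable ?W" for h :: "'v \<Rightarrow> ennreal"
    using walk_coordinate_in[of N "{v}"] walk_coordinate_fun by auto
  have "c * emeasure ?W {z. z N = v} = (\<integral>\<^sup>+z. c * indicator {v} (z N) \<partial>?W)"
  proof -
    have "(\<integral>\<^sup>+z. c * indicator {z. z N = v} z \<partial>?W) = c * emeasure ?W {z. z N = v}"
      by (rule nn_integral_cmult_indicator) measurable
    moreover have "indicator {z. z N = v} z = (indicator {v} (z N) :: ennreal)" for z :: "nat \<Rightarrow> 'v"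
      by (simp add: indicator_def)
    ultimately show ?thesis by simp
  qed
  moreover have "(\<integral>\<^sup>+z. u (z (Suc N)) \<partial>?W) = (\<integral>\<^sup>+z. (\<integral>\<^sup>+b. u b \<partial>measure_pmf (walk_step E r (z N))) \<partial>?W)"
    using walk_transition[where A=UNIV and n=N and u=u and E=E and r=r and x=x] by simp
  ultimately have "c * emeasure ?W {z. z N = v} + (\<integral>\<^sup>+z. u (z (Suc N)) \<partial>?W) =
      (\<integral>\<^sup>+z. c * indicator {v} (z N) + (\<integral>\<^sup>+b. u b \<partial>measure_pmf (walk_step E r (z N))) \<partial>?W)"
    by (subst nn_integral_add) auto
  also have "\<dots> \<le> (\<integral>\<^sup>+z. u (z N) \<partial>?W)"
    by (rule nn_integral_mono_AE, rule eventually_mono[OF walk_AE_path[OF assms(1)]])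
      (use u in \<open>simp add: add.commute\<close>)
  finally show ?case
    using Suc by (simp add: add.assoc) (meson add_left_mono order_trans)
qed

text \<open>Division by the degree \<open>1 + card (ch a)\<close> turns an inequality between sums
  over neighbours into one for the transition kernel.\<close>

lemma walk_step_superharmonic:
  fixes u :: "'v \<Rightarrow> real"
  assumes "a \<in> V" "a \<noteq> r" "\<And>b. 0 \<le> u b" "0 \<le> k"
    and "(\<Sum>b\<in>ch a. u b) + u (par a) + k \<le> (1 + real (card (ch a))) * u a"
  shows "(\<integral>\<^sup>+b. ennreal (u b) \<partial>measure_pmf (walk_step E r a)) + ennreal (k / (1 + real (card (ch a)))) \<le> ennreal (u a)"
proof -
  let ?N = "insert (par a) (ch a)" and ?c = "1 + real (card (ch a))"
  have N: "neighbours E a = ?N" by (rule neighbours_eq[OF assms(1,2)])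
  have "(\<integral>\<^sup>+b. ennreal (u b) \<partial>measure_pmf (walk_step E r a)) = (\<Sum>b\<in>?N. ennreal (u b)) / card ?N"
    using assms(2) N by (simp add: walk_step_def finite_ch nn_integral_pmf_of_set)
  also have "\<dots> = ennreal ((\<Sum>b\<in>?N. u b) / card ?N)"
    using assms(3) finite_ch[of a] by (subst sum_ennreal)
       (auto simp: ennreal_of_nat_eq_real_of_nat divide_ennreal sum_nonneg card_gt_0_iff)
  also have "(\<Sum>b\<in>?N. u b) = (\<Sum>b\<in>ch a. u b) + u (par a)"
    using par_notin_ch[OF assms(1,2)] finite_ch[of a] by simp
  also have "real (card ?N) = ?c"
    using par_notin_ch[OF assms(1,2)] finite_ch[of a] by simp
  finally have "(\<integral>\<^sup>+b. ennreal (u b) \<partial>measure_pmf (walk_step E r a)) + ennreal (k / ?c) =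
      ennreal (((\<Sum>b\<in>ch a. u b) + u (par a)) / ?c + k / ?c)"
    using assms(3,4) by (simp add: sum_nonneg)
  also have "\<dots> \<le> ennreal (u a)"
    using assms(5) unfolding add_divide_distrib[symmetric]
    by (intro ennreal_leI) (simp add: divide_le_eq mult.commute)
  finally show ?thesis .
qed

text \<open>In \<open>x\<close>, the number of common vertices of the geodesics to \<open>x\<close> and \<open>v\<close> is harmonic off the
  root except at \<open>v\<close>, where it is strictly superharmonic; so up to constants it is the Green
  function and bounds the expected number of visits to \<open>v\<close>.\<close>

definition meet_size :: "'v \<Rightarrow> 'v \<Rightarrow> real" where
  "meet_size v x = card (set (gpath x) \<inter> set (gpath v))"

lemma meet_size_child:
  assumes "y \<in> ch x"
  shows "meet_size v y = meet_size v x + indicator (set (gpath v)) y"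
proof -
  note c = childD[OF assms]
  have "y \<notin> set (gpath x)" using geodesic_distinct[OF gpath(1)[OF c(3)]] c(4) by simp
  then show ?thesis using c(4) by (auto simp: meet_size_def indicator_def)
qed

text \<open>A child gains 1 exactly if it lies on the geodesic to \<open>v\<close>. A vertex of this
  geodesic exceeds its parent by 1 and has one gaining child, except \<open>v\<close>, which has
  none. Off the geodesic all neighbours have the same value.\<close>

lemma meet_size_superharmonic:
  assumes v: "v \<in> V" and a: "a \<in> V" "a \<noteq> r"
  shows "(\<Sum>b\<in>ch a. meet_size v b) + meet_size v (par a) + indicator {v} a \<le> (1 + real (card (ch a))) * meet_size v a"
proof -
  let ?s = "\<lambda>b. indicator (set (gpath v)) b :: real"
  have on_path: "gpath v ! lev b = b" "lev b \<le> lev v" if "b \<in> set (gpath v)" for b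
    using that lev_nth[OF v] length_gpath[OF v] by (auto simp: in_set_conv_nth less_Suc_eq_le)
  have "(\<Sum>b\<in>ch a. ?s b) + indicator {v} a \<le> ?s a"
  proof (cases "\<exists>b\<in>ch a. b \<in> set (gpath v)")
    case True
    then obtain b where b: "b \<in> ch a" "b \<in> set (gpath v)" by blast
    note c = childD[OF b(1)]
    have "ch a \<inter> set (gpath v) = {b}"
      using b on_path(1) childD(5) by (auto) (metis)
    then have "(\<Sum>b\<in>ch a. ?s b) = 1" using finite_ch[of a] by (simp add: sum.If_cases indicator_def)
    moreover have "a \<noteq> v" using on_path(2)[OF b(2)] c(5) by auto
    moreover have "gpath b = take (Suc (lev b)) (gpath v)"
      using gpath_nth[OF v, of "lev b"] on_path[OF b(2)] length_gpath[OF v] by simp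
    then have "set (gpath b) \<subseteq> set (gpath v)" by (simp add: set_take_subset)
    then have "a \<in> set (gpath v)" using c(4) gpath(3,4)[OF c(2)] by (metis Un_iff last_in_set set_append subsetD)
    ultimately show ?thesis by simp
  next
    case False
    then have "(\<Sum>b\<in>ch a. ?s b) = 0" by (intro sum.neutral) auto
    moreover have "v \<in> set (gpath v)" using gpath(3,4)[OF v] by (metis last_in_set)
    ultimately show ?thesis by (auto simp: indicator_def)
  qed
  moreover have "(\<Sum>b\<in>ch a. meet_size v b) = card (ch a) * meet_size v a + (\<Sum>b\<in>ch a. ?s b)"
    by (simp add: meet_size_child sum.distrib)
  moreover have "meet_size v a = meet_size v (par a) + ?s a" by (rule meet_size_child[OF child_par[OF a]])
  ultimately show ?thesis by (simp add: algebra_simps)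
qed

text \<open>The expected number of visits to \<open>v\<close> is at most
  \<open>meet_size v x / c\<close>, so Borel-Cantelli applies. Here \<open>c\<close> is the deficit
  1 of \<open>meet_size\<close> at \<open>v\<close> divided by the degree of
  \<open>v\<close>.\<close>

lemma walk_finite_visits:
  assumes x: "x \<in> V" and v: "v \<in> V" "v \<noteq> r"
  shows "AE z in walk_law E r x. \<forall>\<^sub>F n in sequentially. z n \<noteq> v"
proof -
  let ?W = "walk_law E r x"
  interpret prob_space ?W by (rule prob_space_walk_law)
  define c where "c = 1 / (1 + real (card (ch v)))"
  have c: "0 < c" by (simp add: c_def)
  let ?u = "\<lambda>a. ennreal (meet_size v a)"
  have u: "(\<integral>\<^sup>+b. ?u b \<partial>measure_pmf (walk_step E r a)) + ennreal c * indicator {v} a \<le> ?u a" if a: "a \<in> V" for a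
  proof (cases "a = r")
    case True then show ?thesis using v by (simp add: walk_step_def)
  next
    case False
    have "ennreal c * indicator {v} a = ennreal (indicator {v} a / (1 + real (card (ch a))))"
      by (simp add: c_def split: split_indicator)
    then show ?thesis
      using walk_step_superharmonic[OF a False _ _ meet_size_superharmonic[OF v(1) a False]]
      by (simp add: meet_size_def)
  qed
  have bound: "(\<Sum>i<N. prob {z. z i = v}) \<le> meet_size v x / c" for N
  proof -
    have "(\<Sum>i<N. ennreal c * emeasure ?W {z. z i = v}) \<le> ?u x"
      using superharmonic_bound[OF x u, of N] by (meson le_iff_add order_trans)
    moreover have "(\<Sum>i<N. ennreal c * emeasure ?W {z. z i = v}) = ennreal (\<Sum>i<N. c * prob {z. z i = v})"
      using c by (simp add: emeasure_eq_measure ennreal_mult[symmetric] sum_ennreal)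
    ultimately have "(\<Sum>i<N. c * prob {z. z i = v}) \<le> meet_size v x"
      by (simp add: meet_size_def)
    then show ?thesis using c by (simp add: sum_distrib_left[symmetric] field_simps)
  qed
  have meas: "{z. z n = v} \<in> events" for n
    using walk_coordinate_in[of n "{v}"] by simp
  have "AE z in ?W. \<forall>\<^sub>F n in sequentially. z \<in> space ?W - {z. z n = v}"
  proof (rule borel_cantelli_AE1[OF meas])
    show "summable (\<lambda>n. prob {z. z n = v})"
      using bound by (intro bounded_imp_summable[where B="meet_size v x / c"])
        (simp_all only: lessThan_Suc_atMost[symmetric] measure_nonneg)
  qed (simp add: emeasure_eq_measure)
  then show ?thesis by simp
qed

end

section \<open>Convergence of the walk to the boundary\<close>

context rooted_tree
begin

section \<open>Neighbourhood bases in the boundary and the compactification\<close>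

abbreviation bd :: "(nat \<Rightarrow> 'v) set" where "bd \<equiv> tree_boundary E \<omega> r"
abbreviation cpt :: "('v + (nat \<Rightarrow> 'v)) topology" where "cpt \<equiv> compactification V E \<omega> r"
abbreviation nbhd :: "'v \<Rightarrow> ('v + (nat \<Rightarrow> 'v)) set" where "nbhd v \<equiv> Inl ` below v \<union> Inr ` cyl v"

lemma bd_ch: "\<zeta> \<in> bd \<Longrightarrow> \<zeta> (Suc n) \<in> ch (\<zeta> n)"
  by (simp add: boundary_iff)

lemma bd_neq_root: "\<zeta> \<in> bd \<Longrightarrow> 1 \<le> k \<Longrightarrow> \<zeta> k \<noteq> r"
  using boundary_gpath(2)[of \<zeta> k] lev_root by auto

lemma root_notin_below: "v \<in> V \<Longrightarrow> v \<noteq> r \<Longrightarrow> r \<notin> below v"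
  using lev_eq_0[of v] lev_root by (auto simp: below_def)

lemma below_antimono:
  assumes "\<zeta> \<in> bd" shows "below (\<zeta> (k + d)) \<subseteq> below (\<zeta> k)"
proof (induction d)
  case (Suc d)
  have "below (\<zeta> (Suc (k + d))) \<subseteq> below (\<zeta> (k + d))"
  proof
    fix x assume x: "x \<in> below (\<zeta> (Suc (k + d)))"
    have l: "lev (\<zeta> m) = m" for m using boundary_gpath(2)[OF assms] .
    have xV: "x \<in> V" "Suc (k + d) \<le> lev x" "gpath x ! Suc (k + d) = \<zeta> (Suc (k + d))"
      using x by (auto simp: below_def l)
    have "map \<zeta> [0..<Suc (Suc (k + d))] = take (Suc (Suc (k + d))) (gpath x)"
      using gpath_nth[OF xV(1), of "Suc (k + d)"] xV length_gpath[OF xV(1)] boundary_gpath(3)[OF assms] by simp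
    then have "map \<zeta> [0..<Suc (Suc (k + d))] ! (k + d) = take (Suc (Suc (k + d))) (gpath x) ! (k + d)"
      by simp
    then have "\<zeta> (k + d) = gpath x ! (k + d)"
      by (simp del: upt_Suc)
    then show "x \<in> below (\<zeta> (k + d))" using xV l[of "k + d"] by (simp add: below_def)
  qed
  then show ?case using Suc by auto
qed simp

lemma cyl_antimono:
  assumes "\<zeta> \<in> bd" shows "cyl (\<zeta> (k + d)) \<subseteq> cyl (\<zeta> k)"
proof
  fix \<xi> assume "\<xi> \<in> cyl (\<zeta> (k + d))"
  then have \<xi>: "\<xi> \<in> bd" "\<xi> (k + d) = \<zeta> (k + d)" using boundary_gpath(2)[OF assms] by (auto simp: cyl_def)
  have "map \<xi> [0..<Suc (k + d)] ! k = map \<zeta> [0..<Suc (k + d)] ! k"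
    using boundary_gpath(3)[OF assms, of "k + d"] boundary_gpath(3)[OF \<xi>(1), of "k + d"] \<xi>(2) by metis
  then show "\<xi> \<in> cyl (\<zeta> k)" using \<xi>(1) boundary_gpath(2)[OF assms] by (simp add: cyl_def del: upt_Suc)
qed

lemma nbhd_antimono: "\<zeta> \<in> bd \<Longrightarrow> k \<le> l \<Longrightarrow> nbhd (\<zeta> l) \<subseteq> nbhd (\<zeta> k)"
  using below_antimono[of \<zeta> k "l - k"] cyl_antimono[of \<zeta> k "l - k"] by auto

lemma self_cyl: "\<zeta> \<in> bd \<Longrightarrow> \<zeta> \<in> cyl (\<zeta> k)"
  using boundary_gpath(2) by (simp add: cyl_def)

text \<open>Induction over the generation of the open set; finite intersections are handled by the
  nesting of the cylinders along \<zeta>. The condition \<open>1 \<le> k\<close> keeps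
  \<open>\<zeta> k\<close> off the root, so that it has a parent edge.\<close>

lemma boundary_open_cyl:
  assumes "openin (boundary_topology E \<omega> r) U" "\<zeta> \<in> U"
  shows "\<zeta> \<in> bd \<and> (\<exists>k\<ge>1. cyl (\<zeta> k) \<subseteq> U)"
proof -
  have "generate_topology_on (boundary_through E \<omega> r ` E) U"
    using assms(1) by (simp add: boundary_topology_def openin_topology_generated_by_iff)
  then show ?thesis using assms(2)
  proof (induction U)
    case (Int a b)
    then obtain k l where kl: "\<zeta> \<in> bd" "1 \<le> k" "cyl (\<zeta> k) \<subseteq> a" "1 \<le> l" "cyl (\<zeta> l) \<subseteq> b" by auto
    have "cyl (\<zeta> (k + l)) \<subseteq> a \<inter> b"
      using kl cyl_antimono[OF kl(1), of k l] cyl_antimono[OF kl(1), of l k] by (auto simp: add.commute)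
    then show ?case using kl by (intro conjI exI[of _ "k + l"]) auto
  next
    case (UN K)
    then obtain k where k: "k \<in> K" "\<zeta> \<in> k" by auto
    then have "\<zeta> \<in> bd \<and> (\<exists>n\<ge>1. cyl (\<zeta> n) \<subseteq> k)" using UN by blast
    then show ?case using k by blast
  next
    case (Basis s)
    then obtain e where e: "e \<in> E" "s = boundary_through E \<omega> r e" by blast
    obtain v where v: "v \<in> V" "v \<noteq> r" "e = {par v, v}"
      using e(1) E_eq by blast
    have s: "s = cyl v" using e v boundary_through_eq by simp
    then have "\<zeta> \<in> bd" "\<zeta> (lev v) = v" using Basis by (auto simp: cyl_def)
    moreover have "1 \<le> lev v" using v lev_eq_0[of v] by simp
    ultimately show ?case using s by (intro conjI exI[of _ "lev v"]) auto
  qed simp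
qed

lemma comp_open_nbhd:
  assumes "openin cpt U" "Inr \<zeta> \<in> U"
  shows "\<zeta> \<in> bd \<and> (\<exists>k\<ge>1. nbhd (\<zeta> k) \<subseteq> U)"
proof -
  have "generate_topology_on ((\<lambda>x. {Inl x}) ` V \<union>
      (\<lambda>\<alpha>. Inl ` vertices_through E r \<alpha> \<union> Inr ` boundary_through E \<omega> r \<alpha>) ` E) U"
    using assms(1) by (simp add: compactification_def openin_topology_generated_by_iff)
  then show ?thesis using assms(2)
  proof (induction U)
    case (Int a b)
    then obtain k l where kl: "\<zeta> \<in> bd" "1 \<le> k" "nbhd (\<zeta> k) \<subseteq> a" "1 \<le> l" "nbhd (\<zeta> l) \<subseteq> b" by auto
    have "nbhd (\<zeta> (k + l)) \<subseteq> a" by (rule order_trans[OF nbhd_antimono[OF kl(1)] kl(3)]) simp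
    moreover have "nbhd (\<zeta> (k + l)) \<subseteq> b" by (rule order_trans[OF nbhd_antimono[OF kl(1)] kl(5)]) simp
    ultimately have "nbhd (\<zeta> (k + l)) \<subseteq> a \<inter> b" by (rule Int_greatest)
    then show ?case using kl by (intro conjI exI[of _ "k + l"]) auto
  next
    case (UN K)
    then obtain k where k: "k \<in> K" "Inr \<zeta> \<in> k" by auto
    then have "\<zeta> \<in> bd \<and> (\<exists>n\<ge>1. nbhd (\<zeta> n) \<subseteq> k)" using UN by blast
    then show ?case using k by blast
  next
    case (Basis s)
    then obtain e where e: "e \<in> E" "s = Inl ` vertices_through E r e \<union> Inr ` boundary_through E \<omega> r e" by blast
    obtain v where v: "v \<in> V" "v \<noteq> r" "e = {par v, v}"
      using e(1) E_eq by blast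
    have s: "s = nbhd v" using e v boundary_through_eq vertices_through_eq by simp
    then have "\<zeta> \<in> bd" "\<zeta> (lev v) = v" using Basis by (auto simp: cyl_def)
    moreover have "1 \<le> lev v" using v lev_eq_0[of v] by simp
    ultimately show ?case using s by (intro conjI exI[of _ "lev v"]) auto
  qed simp
qed

lemma openin_comp_nbhd:
  assumes "v \<in> V" "v \<noteq> r" shows "openin cpt (nbhd v)"
proof -
  have "{par v, v} \<in> E" using childD(1)[OF child_par[OF assms]] .
  then show ?thesis
    unfolding compactification_def boundary_through_eq[OF assms, symmetric] vertices_through_eq[OF assms, symmetric]
    by (intro topology_generated_by_Basis) auto
qed

lemma openin_comp_vertex: "v \<in> V \<Longrightarrow> openin cpt {Inl v}"
  unfolding compactification_def by (intro topology_generated_by_Basis) auto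

text \<open>A form of convergence free of topology; \<open>limitin_Inr\<close> identifies it with
  convergence to \<open>Inr \<zeta>\<close> in the compactification.\<close>

definition converges :: "(nat \<Rightarrow> 'v) \<Rightarrow> (nat \<Rightarrow> 'v) \<Rightarrow> bool" where
  "converges z \<zeta> \<longleftrightarrow> \<zeta> \<in> bd \<and> (\<forall>k. \<forall>\<^sub>F n in sequentially. z n \<in> below (\<zeta> k))"

lemma limitin_Inr: "limitin cpt (\<lambda>n. Inl (z n)) (Inr \<zeta>) sequentially \<longleftrightarrow> converges z \<zeta>"
proof
  assume L: "limitin cpt (\<lambda>n. Inl (z n)) (Inr \<zeta>) sequentially"
  then have "Inr \<zeta> \<in> topspace cpt" by (simp add: limitin_def)
  then have \<zeta>: "\<zeta> \<in> bd" using comp_open_nbhd[of "topspace cpt"] by auto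
  have "\<forall>\<^sub>F n in sequentially. z n \<in> below (\<zeta> k)" for k
  proof -
    \<comment> \<open>The shift to \<open>Suc k\<close> covers \<open>k = 0\<close>: \<zeta> starts
      at the root, which has no parent edge to define a basic open set.\<close>
    have "openin cpt (nbhd (\<zeta> (Suc k)))"
      using boundary_gpath(1)[OF \<zeta>] bd_neq_root[OF \<zeta>] by (intro openin_comp_nbhd) auto
    moreover have "Inr \<zeta> \<in> nbhd (\<zeta> (Suc k))" using self_cyl[OF \<zeta>] by simp
    ultimately have "\<forall>\<^sub>F n in sequentially. Inl (z n) \<in> nbhd (\<zeta> (Suc k))"
      using L unfolding limitin_def by blast
    then show ?thesis by eventually_elim (use below_antimono[OF \<zeta>, of k 1] in auto)
  qed
  then show "converges z \<zeta>" using \<zeta> by (simp add: converges_def)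
next
  assume C: "converges z \<zeta>"
  then have \<zeta>: "\<zeta> \<in> bd" by (simp add: converges_def)
  have "openin cpt (nbhd (\<zeta> 1))"
    using boundary_gpath(1)[OF \<zeta>] bd_neq_root[OF \<zeta>] by (intro openin_comp_nbhd) auto
  then have "Inr \<zeta> \<in> topspace cpt" using self_cyl[OF \<zeta>, of 1] openin_subset by blast
  moreover have "\<forall>\<^sub>F n in sequentially. Inl (z n) \<in> U" if U: "openin cpt U" "Inr \<zeta> \<in> U" for U
  proof -
    obtain k where k: "nbhd (\<zeta> k) \<subseteq> U" using comp_open_nbhd[OF U] by blast
    have "\<forall>\<^sub>F n in sequentially. z n \<in> below (\<zeta> k)" using C by (simp add: converges_def)
    then show ?thesis by eventually_elim (use k in auto)
  qed
  ultimately show "limitin cpt (\<lambda>n. Inl (z n)) (Inr \<zeta>) sequentially" by (simp add: limitin_def)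
qed

lemma limitin_root:
  "limitin cpt (\<lambda>n. Inl (z n)) (Inl r) sequentially \<Longrightarrow> \<forall>\<^sub>F n in sequentially. z n = r"
  using openin_comp_vertex[OF root_vertex] by (auto simp: limitin_def)

lemma converges_unique:
  assumes "converges z \<zeta>" "converges z \<xi>" shows "\<zeta> = \<xi>"
proof
  fix k
  have bd: "\<zeta> \<in> bd" "\<xi> \<in> bd" using assms by (auto simp: converges_def)
  have "\<forall>\<^sub>F n in sequentially. z n \<in> below (\<zeta> k) \<and> z n \<in> below (\<xi> k)"
    using assms by (auto simp: converges_def intro: eventually_conj)
  then obtain n where "z n \<in> below (\<zeta> k)" "z n \<in> below (\<xi> k)"
    using eventually_happens' sequentially_bot by blast
  then show "\<zeta> k = \<xi> k" using bd boundary_gpath(2) by (simp add: below_def)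
qed

lemma converges_not_root:
  assumes "converges z \<zeta>" shows "\<not> (\<forall>\<^sub>F n in sequentially. z n = r)"
proof
  assume "\<forall>\<^sub>F n in sequentially. z n = r"
  moreover have "\<forall>\<^sub>F n in sequentially. z n \<in> below (\<zeta> 1)" using assms by (simp add: converges_def)
  ultimately have "\<forall>\<^sub>F n in sequentially. z n = r \<and> z n \<in> below (\<zeta> 1)" by (rule eventually_conj)
  then obtain n where "z n = r" "z n \<in> below (\<zeta> 1)"
    using eventually_happens' sequentially_bot by blast
  then show False using assms boundary_gpath(2)[of \<zeta> 1] lev_root by (auto simp: below_def converges_def)
qed

lemma walk_limit_Inr:
  assumes "converges z \<zeta>" shows "walk_limit V E \<omega> r z = Inr \<zeta>"
proof -
  let ?P = "\<lambda>l. l \<in> exit_points E \<omega> r \<and> limitin cpt (\<lambda>n. Inl (z n)) l sequentially"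
  have "?P (Inr \<zeta>)" using assms by (auto simp: limitin_Inr exit_points_def converges_def)
  moreover have "l = Inr \<zeta>" if "?P l" for l
    using that converges_unique[OF assms] converges_not_root[OF assms] limitin_root[of z]
    by (auto simp: exit_points_def limitin_Inr)
  ultimately have "\<exists>l. ?P l" "(THE l. ?P l) = Inr \<zeta>" by (blast, intro the_equality)
  then show ?thesis unfolding walk_limit_def Let_def by simp
qed

text \<open>This includes paths absorbed at the root as well as paths without any limit, for which
  the root is the default value.\<close>

lemma walk_limit_root:
  assumes "\<nexists>\<zeta>. converges z \<zeta>" shows "walk_limit V E \<omega> r z = Inl r"
proof -
  let ?P = "\<lambda>l. l \<in> exit_points E \<omega> r \<and> limitin cpt (\<lambda>n. Inl (z n)) l sequentially"
  have P: "l = Inl r" if "?P l" for l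
    using that assms by (auto simp: exit_points_def limitin_Inr)
  have "(THE l. ?P l) = Inl r" if "\<exists>l. ?P l"
    using that P by (metis (mono_tags, lifting) the_equality)
  then show ?thesis unfolding walk_limit_def Let_def by simp
qed

section \<open>Almost sure convergence of the walk\<close>

lemma gpath_nth_child:
  assumes "x \<in> V" "Suc k \<le> lev x" shows "gpath x ! Suc k \<in> ch (gpath x ! k)"
proof -
  have "gpath x ! Suc k \<noteq> r" using lev_nth(1)[OF assms] lev_root by auto
  moreover have "par (gpath x ! Suc k) = gpath x ! k"
    using gpath_nth[OF assms(1), of "Suc k"] lev_nth[OF assms] length_gpath[OF assms(1)] assms
    by (simp add: par_def)
  ultimately show ?thesis using child_par[of "gpath x ! Suc k"] lev_nth(2)[OF assms] by simp
qed

text \<open>Expresses convergence by countable operations on simple events, as measurability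
  requires. Conversely, vertices chosen on consecutive levels are parent and child, since some
  \<open>z n\<close> lies below both.\<close>

lemma converges_iff:
  "(\<exists>\<zeta>. converges z \<zeta>) \<longleftrightarrow> (\<forall>k. \<exists>u\<in>level k. \<forall>\<^sub>F n in sequentially. z n \<in> below u)"
proof
  assume "\<exists>\<zeta>. converges z \<zeta>"
  then obtain \<zeta> where "converges z \<zeta>" by blast
  then have "\<zeta> k \<in> level k \<and> (\<forall>\<^sub>F n in sequentially. z n \<in> below (\<zeta> k))" for k
    using boundary_gpath(1,2)[of \<zeta> k] by (simp add: converges_def level_def)
  then show "\<forall>k. \<exists>u\<in>level k. \<forall>\<^sub>F n in sequentially. z n \<in> below u" by blast
next
  assume "\<forall>k. \<exists>u\<in>level k. \<forall>\<^sub>F n in sequentially. z n \<in> below u"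
  then obtain \<zeta> where \<zeta>: "\<And>k. \<zeta> k \<in> level k" "\<And>k. \<forall>\<^sub>F n in sequentially. z n \<in> below (\<zeta> k)" by metis
  have "\<zeta> (Suc k) \<in> ch (\<zeta> k)" for k
  proof -
    have "\<forall>\<^sub>F n in sequentially. z n \<in> below (\<zeta> k) \<and> z n \<in> below (\<zeta> (Suc k))"
      using \<zeta>(2) by (intro eventually_conj) auto
    then obtain n where "z n \<in> below (\<zeta> k)" "z n \<in> below (\<zeta> (Suc k))"
      using eventually_happens' sequentially_bot by blast
    then show ?thesis using gpath_nth_child[of "z n" k] \<zeta>(1)[of k] \<zeta>(1)[of "Suc k"]
      by (auto simp: below_def level_def)
  qed
  moreover have "\<zeta> 0 = r" using \<zeta>(1)[of 0] level_0 by simp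
  ultimately have "\<zeta> \<in> bd" by (simp add: boundary_iff)
  then show "\<exists>\<zeta>. converges z \<zeta>" using \<zeta>(2) by (auto simp: converges_def)
qed

lemma converges_cyl_iff:
  assumes v: "v \<in> V" and c: "converges z \<zeta>"
  shows "\<zeta> \<in> cyl v \<longleftrightarrow> (\<forall>\<^sub>F n in sequentially. z n \<in> below v)"
    and "\<zeta> \<notin> cyl v \<longleftrightarrow> (\<forall>\<^sub>F n in sequentially. z n \<notin> below v)"
proof -
  have bd: "\<zeta> \<in> bd" and e: "\<forall>\<^sub>F n in sequentially. z n \<in> below (\<zeta> (lev v))"
    using c by (auto simp: converges_def)
  have l: "lev (\<zeta> (lev v)) = lev v" using boundary_gpath(2)[OF bd] .
  have 1: "\<forall>\<^sub>F n in sequentially. z n \<in> below v" if "\<zeta> \<in> cyl v"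
    using that e by (simp add: cyl_def)
  have 2: "\<forall>\<^sub>F n in sequentially. z n \<notin> below v" if "\<zeta> \<notin> cyl v"
    using e by eventually_elim (use that bd l in \<open>auto simp: cyl_def below_def\<close>)
  have 3: False if "\<forall>\<^sub>F n in sequentially. z n \<in> below v" "\<forall>\<^sub>F n in sequentially. z n \<notin> below v"
    using eventually_conj[OF that] by simp
  show "\<zeta> \<in> cyl v \<longleftrightarrow> (\<forall>\<^sub>F n in sequentially. z n \<in> below v)"
    and "\<zeta> \<notin> cyl v \<longleftrightarrow> (\<forall>\<^sub>F n in sequentially. z n \<notin> below v)"
    using 1 2 3 by blast+
qed

lemma walk_limit_in_cyl:
  assumes "v \<in> V"
  shows "walk_limit V E \<omega> r z \<in> Inr ` cyl v \<longleftrightarrow>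
    (\<exists>\<zeta>. converges z \<zeta>) \<and> (\<forall>\<^sub>F n in sequentially. z n \<in> below v)"
proof (cases "\<exists>\<zeta>. converges z \<zeta>")
  case True
  then obtain \<zeta> where "converges z \<zeta>" by blast
  then show ?thesis using converges_cyl_iff(1)[OF assms, of z \<zeta>] walk_limit_Inr[of z \<zeta>] by auto
next
  case False
  then show ?thesis using walk_limit_root[OF False] by auto
qed

text \<open>The path finally leaves the finite set of vertices of level at most \<open>k\<close>.
  From then on its ancestor on level \<open>k\<close> is constant, because adjacent vertices of
  higher level share it.\<close>

lemma path_converges:
  assumes path: "\<And>n. z n \<in> V" "\<And>n. if z n = r then z (Suc n) = r else adj (z n) (z (Suc n))"
    and fin: "\<And>v. v \<in> V \<Longrightarrow> v \<noteq> r \<Longrightarrow> \<forall>\<^sub>F n in sequentially. z n \<noteq> v"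
    and not_absorbed: "\<not> (\<forall>\<^sub>F n in sequentially. z n = r)"
  shows "\<exists>\<zeta>. converges z \<zeta>"
  unfolding converges_iff
proof
  fix k
  \<comment> \<open>The root is absorbing, so a path not eventually at the root never visits
    it.\<close>
  have nr: "z n \<noteq> r" for n
  proof
    assume n: "z n = r"
    have "z m = r" if "n \<le> m" for m
      using that
    proof (induction m rule: dec_induct)
      case (step m) then show ?case using path(2)[of m] by simp
    qed (use n in simp)
    then show False using not_absorbed eventually_sequentially by blast
  qed
  let ?B = "\<Union>j\<in>{..k}. level j"
  have "\<forall>\<^sub>F n in sequentially. \<forall>v\<in>?B. z n \<noteq> v"
  proof (intro eventually_ball_finite ballI)
    show "finite ?B" by (simp add: finite_level)
    fix v assume "v \<in> ?B"
    then have "v \<in> V" by (auto simp: level_def)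
    then show "\<forall>\<^sub>F n in sequentially. z n \<noteq> v" using fin nr by (cases "v = r") auto
  qed
  then obtain N where "\<And>n. N \<le> n \<Longrightarrow> z n \<notin> ?B" unfolding eventually_sequentially by blast
  then have N: "k < lev (z n)" if "N \<le> n" for n
    using that path(1)[of n] by (auto simp: level_def not_le)
  have eq: "gpath (z n) ! k = gpath (z N) ! k" if "N \<le> n" for n
    using that
  proof (induction n rule: dec_induct)
    case (step n)
    have "adj (z n) (z (Suc n))" using path(2)[of n] nr by simp
    then have "z (Suc n) \<in> ch (z n) \<or> z n \<in> ch (z (Suc n))" by (rule adj_cases)
    then have "gpath (z (Suc n)) ! k = gpath (z n) ! k"
    proof
      assume "z (Suc n) \<in> ch (z n)"
      then show ?thesis using childD(4)[of "z (Suc n)" "z n"] N[of n] step length_gpath[OF path(1), of n]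
        by (simp add: nth_append)
    next
      assume "z n \<in> ch (z (Suc n))"
      then show ?thesis using childD(4)[of "z n" "z (Suc n)"] N[of "Suc n"] step length_gpath[OF path(1), of "Suc n"]
        by (simp add: nth_append)
    qed
    then show ?case using step by simp
  qed simp
  have "gpath (z N) ! k \<in> level k" "lev (gpath (z N) ! k) = k"
    using lev_nth[OF path(1), of k N] N[of N] by (auto simp: level_def)
  moreover have "z n \<in> below (gpath (z N) ! k)" if "N \<le> n" for n
    using eq[OF that] N[OF that] path(1)[of n] calculation(2) by (simp add: below_def)
  ultimately show "\<exists>u\<in>level k. \<forall>\<^sub>F n in sequentially. z n \<in> below u"
    unfolding eventually_sequentially by blast
qed

lemma walk_AE_limit:
  assumes x: "x \<in> V"
  shows "AE z in walk_law E r x. (\<forall>\<^sub>F n in sequentially. z n = r) \<or> (\<exists>\<zeta>. converges z \<zeta>)"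
proof -
  have "AE z in walk_law E r x. \<forall>v\<in>V - {r}. \<forall>\<^sub>F n in sequentially. z n \<noteq> v"
    using walk_finite_visits[OF x] countable_V by (intro AE_ball_countable') auto
  with walk_AE_path[OF x] show ?thesis
  proof eventually_elim
    case (elim z)
    then show ?case using path_converges[of z] by blast
  qed
qed

section \<open>The probability of exiting outside a cylinder\<close>

definition leave_bound :: "'v \<Rightarrow> 'v \<Rightarrow> real" where
  "leave_bound v a = (if a \<in> below v then min 1 (hit a / hit v) else 1)"

text \<open>This is conservation of flow for the drops of \<open>hit\<close>, written in terms of
  \<open>hit\<close> itself.\<close>

lemma hit_harmonic:
  assumes "a \<in> V" "a \<noteq> r"
  shows "(\<Sum>b\<in>ch a. hit b) + hit (par a) = (1 + real (card (ch a))) * hit a"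
proof -
  have "(\<Sum>b\<in>ch a. drop_of Qlim b) = (\<Sum>b\<in>ch a. hit a - hit b)"
    using childD(6) by (intro sum.cong) (simp_all add: drop_of_def)
  then have "(\<Sum>b\<in>ch a. hit a - hit b) = hit (par a) - hit a"
    using drop_of_hit_flow[OF assms] by (simp add: drop_of_def)
  then show ?thesis by (simp add: sum_subtractf algebra_simps)
qed

text \<open>Where the function takes its maximal value 1 nothing is to be shown. Elsewhere all
  neighbours lie below \<open>v\<close> and are bounded by the harmonic function
  \<open>hit / hit v\<close>, with equality at \<open>a\<close>.\<close>

lemma leave_bound_superharmonic:
  assumes v: "v \<in> V" and a: "a \<in> V" "a \<noteq> r"
  shows "(\<Sum>b\<in>ch a. leave_bound v b) + leave_bound v (par a) \<le> (1 + real (card (ch a))) * leave_bound v a"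
proof (cases "leave_bound v a = 1")
  case True
  have le1: "leave_bound v b \<le> 1" for b by (simp add: leave_bound_def)
  have "(\<Sum>b\<in>ch a. leave_bound v b) \<le> (\<Sum>b\<in>ch a. 1)" using le1 by (intro sum_mono)
  then show ?thesis using True le1[of "par a"] by simp
next
  case False
  then have b: "a \<in> below v" by (auto simp: leave_bound_def split: if_splits)
  then have ea: "leave_bound v a = hit a / hit v" using False by (auto simp: leave_bound_def min_def split: if_splits)
  \<comment> \<open>The value at \<open>v\<close> is 1; hence \<open>a\<close> is strictly below
    \<open>v\<close>, and its parent is still below \<open>v\<close>.\<close>
  have "a \<noteq> v" using False below_self[OF v] hit_pos[of v] by (auto simp: leave_bound_def)
  then have "par a \<in> below v" using below_par[OF b _ v] by simp
  then have "leave_bound v (par a) \<le> hit (par a) / hit v" by (simp add: leave_bound_def)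
  moreover have "leave_bound v c \<le> hit c / hit v" if "c \<in> ch a" for c
    using below_child[OF that b] by (simp add: leave_bound_def)
  then have "(\<Sum>b\<in>ch a. leave_bound v b) \<le> (\<Sum>b\<in>ch a. hit b / hit v)" by (intro sum_mono)
  ultimately have "(\<Sum>b\<in>ch a. leave_bound v b) + leave_bound v (par a) \<le> ((\<Sum>b\<in>ch a. hit b) + hit (par a)) / hit v"
    by (simp add: add_divide_distrib sum_divide_distrib)
  then show ?thesis using hit_harmonic[OF a] ea by simp
qed

lemma UNIV_walk_sets: "UNIV \<in> sets (walk_law E r x)"
  using sets.top[of "walk_law E r x"] by simp

lemma eventually_walk_sets:
  "{z. \<forall>\<^sub>F n in sequentially. z n \<in> A} \<in> sets (walk_law E r x)"
proof -
  have "{z. \<forall>\<^sub>F n in sequentially. z n \<in> A} = (\<Union>N. \<Inter>n\<in>{N..}. {z. z n \<in> A})"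
    by (auto simp: eventually_sequentially)
  also have "\<dots> \<in> sets (walk_law E r x)"
    by (intro sets.countable_UN'' sets.countable_INT'') (auto simp: walk_coordinate_in UNIV_walk_sets)
  finally show ?thesis .
qed

lemma converges_sets: "{z. \<exists>\<zeta>. converges z \<zeta>} \<in> sets (walk_law E r x)"
proof -
  have "{z. \<exists>\<zeta>. converges z \<zeta>} = (\<Inter>k. \<Union>u\<in>level k. {z. \<forall>\<^sub>F n in sequentially. z n \<in> below u})"
    unfolding converges_iff by auto
  also have "\<dots> \<in> sets (walk_law E r x)"
    by (intro sets.countable_INT'' sets.finite_UN) (auto simp: finite_level eventually_walk_sets UNIV_walk_sets)
  finally show ?thesis .
qed

lemma walk_limit_cyl_sets:
  assumes "v \<in> V" shows "{z. walk_limit V E \<omega> r z \<in> Inr ` cyl v} \<in> sets (walk_law E r x)"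
proof -
  have "{z. walk_limit V E \<omega> r z \<in> Inr ` cyl v} =
      {z. \<exists>\<zeta>. converges z \<zeta>} \<inter> {z. \<forall>\<^sub>F n in sequentially. z n \<in> below v}"
    using walk_limit_in_cyl[OF assms] by auto
  also have "\<dots> \<in> sets (walk_law E r x)" by (intro sets.Int converges_sets eventually_walk_sets)
  finally show ?thesis .
qed

text \<open>The supermartingale inequality for \<open>leave_bound v\<close> bounds the probability
  of being outside \<open>below v\<close> at each fixed time. Almost surely, a walk whose limit
  misses the cylinder stays outside \<open>below v\<close> from some time on.\<close>

lemma exit_probability:
  assumes v: "v \<in> V" "v \<noteq> r" and x: "x \<in> below v"
  shows "measure (walk_law E r x) {z. walk_limit V E \<omega> r z \<notin> Inr ` cyl v} \<le> hit x / hit v"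
proof -
  let ?W = "walk_law E r x"
  interpret prob_space ?W by (rule prob_space_walk_law)
  have xV: "x \<in> V" using x by (simp add: below_def)
  have pos: "0 \<le> leave_bound v b" for b
    using hit_pos[of b] hit_pos[of v] by (auto simp: leave_bound_def less_imp_le)
  have sup: "(\<integral>\<^sup>+b. ennreal (leave_bound v b) \<partial>measure_pmf (walk_step E r a)) + 0 * indicator {v} a
      \<le> ennreal (leave_bound v a)" if a: "a \<in> V" for a
  proof (cases "a = r")
    case True then show ?thesis by (simp add: walk_step_def)
  next
    case False
    then show ?thesis
      using walk_step_superharmonic[OF a False pos, of 0] leave_bound_superharmonic[OF v(1) a False] by simp
  qed
  have step: "prob {z. z n \<in> - below v} \<le> hit x / hit v" for n
  proof -
    have "ennreal (prob {z. z n \<in> - below v}) = (\<integral>\<^sup>+z. indicator {z. z n \<in> - below v} z \<partial>?W)"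
      using walk_coordinate_in[of n "- below v" E r x]
      by (simp add: emeasure_eq_measure[symmetric] del: Compl_iff)
    also have "\<dots> \<le> (\<integral>\<^sup>+z. ennreal (leave_bound v (z n)) \<partial>?W)"
      by (intro nn_integral_mono) (simp add: leave_bound_def split: split_indicator)
    also have "\<dots> \<le> ennreal (leave_bound v x)"
      using superharmonic_bound[OF xV sup, of n] by simp
    also have "\<dots> \<le> ennreal (hit x / hit v)"
      using x by (intro ennreal_leI) (simp add: leave_bound_def)
    finally show ?thesis using hit_pos[of x] hit_pos[of v] by (simp add: less_imp_le)
  qed
  \<comment> \<open>The events of staying outside from time \<open>N\<close> on increase with
    \<open>N\<close>, and each lies in the event of being outside at time \<open>N\<close>.\<close>
  let ?A = "\<lambda>N. \<Inter>n\<in>{N..}. {z. z n \<in> - below v}"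
  have Am: "?A N \<in> events" for N
    by (intro sets.countable_INT'') (auto simp: walk_coordinate_in UNIV_walk_sets simp del: Compl_iff)
  have "(\<lambda>N. prob (?A N)) \<longlonglongrightarrow> prob (\<Union>N. ?A N)"
    using Am by (intro finite_Lim_measure_incseq) (auto simp: incseq_def)
  moreover have "prob (?A N) \<le> hit x / hit v" for N
  proof -
    have "prob (?A N) \<le> prob {z. z N \<in> - below v}"
      by (intro finite_measure_mono walk_coordinate_in) auto
    then show ?thesis using step[of N] by linarith
  qed
  ultimately have "prob (\<Union>N. ?A N) \<le> hit x / hit v" by (intro LIMSEQ_le_const2) auto
  moreover have "prob {z. walk_limit V E \<omega> r z \<notin> Inr ` cyl v} \<le> prob (\<Union>N. ?A N)"
  proof (rule finite_measure_mono_AE)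
    show "(\<Union>N. ?A N) \<in> events" using Am by blast
    show "AE z in ?W. z \<in> {z. walk_limit V E \<omega> r z \<notin> Inr ` cyl v} \<longrightarrow> z \<in> (\<Union>N. ?A N)"
      using walk_AE_limit[OF xV]
    proof eventually_elim
      case (elim z)
      show ?case
      proof
        assume nl: "z \<in> {z. walk_limit V E \<omega> r z \<notin> Inr ` cyl v}"
        from elim have "\<forall>\<^sub>F n in sequentially. z n \<notin> below v"
        proof
          assume "\<forall>\<^sub>F n in sequentially. z n = r"
          then show ?thesis by eventually_elim (use root_notin_below[OF v] in simp)
        next
          assume "\<exists>\<zeta>. converges z \<zeta>"
          then obtain \<zeta> where c: "converges z \<zeta>" by blast
          then have "\<zeta> \<notin> cyl v" using nl walk_limit_Inr[OF c] by auto
          then show ?thesis using converges_cyl_iff(2)[OF v(1) c] by blast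
        qed
        then show "z \<in> (\<Union>N. ?A N)" by (auto simp: eventually_sequentially)
      qed
    qed
  qed
  ultimately show ?thesis by linarith
qed

end

section \<open>Boundary behaviour of the Poisson integral\<close>

context rooted_tree
begin

section \<open>Measurability of the limit\<close>

lemma exit_open_Pow:
  "{U. openin (subtopology cpt (exit_points E \<omega> r)) U} \<subseteq> Pow (exit_points E \<omega> r)"
  by (auto simp: openin_subtopology)

lemma space_exit_borel: "space (exit_borel V E \<omega> r) = exit_points E \<omega> r"
  unfolding exit_borel_def by (rule space_measure_of[OF exit_open_Pow])

lemma open_in_exit_borel:
  "openin (subtopology cpt (exit_points E \<omega> r)) U \<Longrightarrow> U \<in> sets (exit_borel V E \<omega> r)"
  unfolding exit_borel_def by (subst sets_measure_of[OF exit_open_Pow]) auto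

text \<open>It suffices to treat open sets. Their boundary part is a union of cylinders indexed by
  the countable set \<open>V\<close>; the paths without boundary limit all have the value
  \<open>Inl r\<close> and enter the preimage together or not at all.\<close>

lemma measurable_walk_limit: "walk_limit V E \<omega> r \<in> measurable (walk_law E r x) (exit_borel V E \<omega> r)"
  unfolding exit_borel_def
proof (rule measurable_measure_of[OF exit_open_Pow])
  show "walk_limit V E \<omega> r \<in> space (walk_law E r x) \<rightarrow> exit_points E \<omega> r"
  proof
    fix z
    show "walk_limit V E \<omega> r z \<in> exit_points E \<omega> r"
    proof (cases "\<exists>\<zeta>. converges z \<zeta>")
      case True
      then obtain \<zeta> where "converges z \<zeta>" by blast
      then show ?thesis using walk_limit_Inr[of z \<zeta>] by (simp add: exit_points_def converges_def)
    next
      case False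
      then show ?thesis using walk_limit_root[OF False] by (simp add: exit_points_def)
    qed
  qed
next
  fix U assume "U \<in> {U. openin (subtopology cpt (exit_points E \<omega> r)) U}"
  then obtain T where T: "openin cpt T" "U = T \<inter> exit_points E \<omega> r"
    by (auto simp: openin_subtopology)
  let ?R = "{z. Inl r \<in> U \<and> \<not> (\<exists>\<zeta>. converges z \<zeta>)}"
  let ?C = "\<Union>v\<in>{v \<in> V. Inr ` cyl v \<subseteq> U}. {z. walk_limit V E \<omega> r z \<in> Inr ` cyl v}"
  have "walk_limit V E \<omega> r z \<in> U \<longleftrightarrow> z \<in> ?R \<union> ?C" for z
  proof (cases "\<exists>\<zeta>. converges z \<zeta>")
    case True
    then obtain \<zeta> where \<zeta>: "converges z \<zeta>" by blast
    note wl = walk_limit_Inr[OF \<zeta>]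
    have "z \<in> ?C" if "Inr \<zeta> \<in> U"
    proof -
      have "Inr \<zeta> \<in> T" using that T by simp
      from comp_open_nbhd[OF T(1) this] obtain k where k: "\<zeta> \<in> bd" "nbhd (\<zeta> k) \<subseteq> T" by blast
      have "Inr ` cyl (\<zeta> k) \<subseteq> exit_points E \<omega> r" by (auto simp: exit_points_def cyl_def)
      then have "Inr ` cyl (\<zeta> k) \<subseteq> U" using k T by blast
      then show ?thesis using wl self_cyl[OF k(1), of k] boundary_gpath(1)[OF k(1), of k]
        by (intro UN_I[of "\<zeta> k"]) auto
    qed
    then show ?thesis using wl \<zeta> by auto
  next
    case False
    then show ?thesis using walk_limit_root[OF False] by auto
  qed
  then have "walk_limit V E \<omega> r -` U \<inter> space (walk_law E r x) = ?R \<union> ?C" by auto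
  moreover have "?R \<in> sets (walk_law E r x)"
  proof (cases "Inl r \<in> U")
    case True
    have "?R = space (walk_law E r x) - {z. \<exists>\<zeta>. converges z \<zeta>}" using True by auto
    then show ?thesis using converges_sets by (metis sets.compl_sets)
  qed simp
  moreover have "?C \<in> sets (walk_law E r x)"
  proof (rule sets.countable_UN')
    show "countable {v \<in> V. Inr ` cyl v \<subseteq> U}"
      using countable_V by (rule countable_subset[rotated]) auto
  qed (auto intro: walk_limit_cyl_sets)
  ultimately show "walk_limit V E \<omega> r -` U \<inter> space (walk_law E r x) \<in> sets (walk_law E r x)"
    by simp
qed

section \<open>Continuous functions on the boundary\<close>

lemma topspace_boundary: "topspace (boundary_topology E \<omega> r) = bd"
proof
  show "topspace (boundary_topology E \<omega> r) \<subseteq> bd" using boundary_open_cyl by blast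
  have "\<zeta> \<in> topspace (boundary_topology E \<omega> r)" if \<zeta>: "\<zeta> \<in> bd" for \<zeta>
  proof -
    have v: "\<zeta> 1 \<in> V" "\<zeta> 1 \<noteq> r" using boundary_gpath(1)[OF \<zeta>] bd_neq_root[OF \<zeta>] by auto
    have "openin (boundary_topology E \<omega> r) (cyl (\<zeta> 1))"
      unfolding boundary_topology_def boundary_through_eq[OF v, symmetric]
      by (intro topology_generated_by_Basis imageI childD(1)[OF child_par[OF v]])
    then show ?thesis using self_cyl[OF \<zeta>] openin_subset by blast
  qed
  then show "bd \<subseteq> topspace (boundary_topology E \<omega> r)" by blast
qed

lemma continuous_boundary_cyl:
  assumes "continuous_map (boundary_topology E \<omega> r) euclideanreal \<phi>" "\<zeta> \<in> bd" "open S" "\<phi> \<zeta> \<in> S"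
  shows "\<exists>k\<ge>1. \<phi> ` cyl (\<zeta> k) \<subseteq> S"
proof -
  have "openin (boundary_topology E \<omega> r) {\<xi> \<in> bd. \<phi> \<xi> \<in> S}"
    using openin_continuous_map_preimage[OF assms(1), of S] assms(3) by (simp add: topspace_boundary)
  from boundary_open_cyl[OF this, of \<zeta>] assms(2,4) show ?thesis by blast
qed

text \<open>A compactness argument as in Koenig's lemma: if \<phi> is unbounded on a cylinder, it is
  unbounded on that of one of the finitely many children. The resulting ray contradicts continuity
  at itself.\<close>

lemma continuous_boundary_bounded:
  assumes "continuous_map (boundary_topology E \<omega> r) euclideanreal \<phi>"
  shows "\<exists>B. \<forall>\<zeta>\<in>bd. \<bar>\<phi> \<zeta>\<bar> \<le> B"
proof (rule ccontr)
  let ?bad = "\<lambda>v. \<not> (\<exists>B. \<forall>\<zeta>\<in>cyl v. \<bar>\<phi> \<zeta>\<bar> \<le> B)"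
  assume unb: "\<not> ?thesis"
  have child: "\<exists>y\<in>ch v. ?bad y" if "v \<in> V" "?bad v" for v
  proof (rule ccontr)
    assume "\<not> ?thesis"
    then have "\<forall>y\<in>ch v. \<exists>B. \<forall>\<zeta>\<in>cyl y. \<bar>\<phi> \<zeta>\<bar> \<le> B" by blast
    then obtain B where B: "\<And>y \<zeta>. y \<in> ch v \<Longrightarrow> \<zeta> \<in> cyl y \<Longrightarrow> \<bar>\<phi> \<zeta>\<bar> \<le> B y" by metis
    have "\<bar>\<phi> \<zeta>\<bar> \<le> (\<Sum>y\<in>ch v. \<bar>B y\<bar>)" if "\<zeta> \<in> cyl v" for \<zeta>
    proof -
      have \<zeta>: "\<zeta> \<in> bd" "\<zeta> (lev v) = v" using that by (auto simp: cyl_def)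
      have c: "\<zeta> (Suc (lev v)) \<in> ch v" using bd_ch[OF \<zeta>(1), of "lev v"] \<zeta>(2) by simp
      have "\<bar>\<phi> \<zeta>\<bar> \<le> \<bar>B (\<zeta> (Suc (lev v)))\<bar>" using B[OF c self_cyl[OF \<zeta>(1)]] by linarith
      also have "\<dots> \<le> (\<Sum>y\<in>ch v. \<bar>B y\<bar>)" using c finite_ch by (intro member_le_sum) auto
      finally show ?thesis .
    qed
    then show False using that by blast
  qed
  have "cyl r = bd" using boundary_iff by (auto simp: cyl_def lev_root)
  then have root: "?bad r" using unb by simp
  have "\<exists>\<zeta>. \<forall>n. (\<zeta> n \<in> V \<and> ?bad (\<zeta> n) \<and> (n = 0 \<longrightarrow> \<zeta> n = r)) \<and> \<zeta> (Suc n) \<in> ch (\<zeta> n)"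
  proof (rule dependent_nat_choice)
    show "\<exists>x. x \<in> V \<and> ?bad x \<and> ((0::nat) = 0 \<longrightarrow> x = r)" using root root_vertex by blast
    fix x n assume "x \<in> V \<and> ?bad x \<and> ((n::nat) = 0 \<longrightarrow> x = r)"
    then show "\<exists>y. (y \<in> V \<and> ?bad y \<and> (Suc n = 0 \<longrightarrow> y = r)) \<and> y \<in> ch x"
      using child[of x] childD(3) by blast
  qed
  then obtain \<zeta> where \<zeta>: "\<And>n. ?bad (\<zeta> n)" "\<zeta> 0 = r" "\<And>n. \<zeta> (Suc n) \<in> ch (\<zeta> n)" by blast
  then have bd: "\<zeta> \<in> bd" by (simp add: boundary_iff)
  obtain k where "\<phi> ` cyl (\<zeta> k) \<subseteq> ball (\<phi> \<zeta>) 1"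
    using continuous_boundary_cyl[OF assms bd, of "ball (\<phi> \<zeta>) 1"] by auto
  then have "\<bar>\<phi> \<xi>\<bar> \<le> \<bar>\<phi> \<zeta>\<bar> + 1" if "\<xi> \<in> cyl (\<zeta> k)" for \<xi>
    using that by (force simp: dist_real_def)
  then show False using \<zeta>(1)[of k] by blast
qed

text \<open>The extension of \<phi> by 0 at the root has open preimages in the exit space, since the
  root is isolated.\<close>

lemma poisson_integrand_measurable:
  assumes "continuous_map (boundary_topology E \<omega> r) euclideanreal \<phi>"
  shows "(\<lambda>l. indicator (Inr ` bd) l * \<phi> (projr l)) \<in> borel_measurable (exit_borel V E \<omega> r)"
proof (rule borel_measurableI)
  fix S :: "real set" assume S: "open S"
  let ?G = "\<lambda>l. indicator (Inr ` bd) l * \<phi> (projr l)"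
  \<comment> \<open>The root is left out because only other vertices have an open
    \<open>nbhd\<close>; the inner vertices in these sets disappear on intersecting with the exit
    space.\<close>
  let ?vs = "{v \<in> V - {r}. \<phi> ` cyl v \<subseteq> S}"
  let ?T = "(if 0 \<in> S then {Inl r} else {}) \<union> (\<Union>v\<in>?vs. nbhd v)"
  have "openin cpt ?T"
    using openin_comp_vertex[OF root_vertex] openin_comp_nbhd
    by (intro openin_Un openin_Union) auto
  moreover have "?G -` S \<inter> exit_points E \<omega> r = ?T \<inter> exit_points E \<omega> r"
  proof (rule set_eqI)
    fix l
    show "l \<in> ?G -` S \<inter> exit_points E \<omega> r \<longleftrightarrow> l \<in> ?T \<inter> exit_points E \<omega> r"
    proof (cases "l \<in> exit_points E \<omega> r")
      case True
      then consider "l = Inl r" | \<zeta> where "l = Inr \<zeta>" "\<zeta> \<in> bd" by (auto simp: exit_points_def)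
      then show ?thesis
      proof cases
        case 1
        moreover have "Inl r \<notin> Inr ` bd" "Inl r \<notin> (\<Union>v\<in>?vs. nbhd v)" using root_notin_below by auto
        ultimately show ?thesis using True by simp
      next
        case 2
        have "(\<exists>v\<in>?vs. \<zeta> \<in> cyl v) \<longleftrightarrow> \<phi> \<zeta> \<in> S"
        proof
          assume "\<phi> \<zeta> \<in> S"
          then obtain k where k: "1 \<le> k" "\<phi> ` cyl (\<zeta> k) \<subseteq> S"
            using continuous_boundary_cyl[OF assms 2(2) S] by blast
          then have "\<zeta> k \<in> ?vs" using boundary_gpath(1)[OF 2(2)] bd_neq_root[OF 2(2)] by auto
          then show "\<exists>v\<in>?vs. \<zeta> \<in> cyl v" using self_cyl[OF 2(2)] by blast
        qed auto
        then show ?thesis using 2 True by auto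
      qed
    qed simp
  qed
  ultimately have "openin (subtopology cpt (exit_points E \<omega> r)) (?G -` S \<inter> exit_points E \<omega> r)"
    by (auto simp: openin_subtopology)
  then show "?G -` S \<inter> space (exit_borel V E \<omega> r) \<in> sets (exit_borel V E \<omega> r)"
    unfolding space_exit_borel by (rule open_in_exit_borel)
qed

text \<open>The integral is split by whether the limit falls into a cylinder on which \<phi> is
  close to its value at \<zeta>. The other event has probability at most
  \<open>hit x / hit ?v\<close>, which tends to 0 along \<zeta>.\<close>

lemma poisson_integral_tendsto:
  assumes cont: "continuous_map (boundary_topology E \<omega> r) euclideanreal \<phi>"
    and \<zeta>: "\<zeta> \<in> bd" and h0: "(\<lambda>j. hit (\<zeta> j)) \<longlonglongrightarrow> 0"
  shows "(\<lambda>j. poisson_integral V E \<omega> r \<phi> (\<zeta> j)) \<longlonglongrightarrow> \<phi> \<zeta>"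
proof (rule LIMSEQ_I)
  fix e :: real assume e: "0 < e"
  let ?G = "\<lambda>l. indicator (Inr ` bd) l * \<phi> (projr l)"
  let ?wl = "walk_limit V E \<omega> r"
  obtain B where B: "\<And>\<xi>. \<xi> \<in> bd \<Longrightarrow> \<bar>\<phi> \<xi>\<bar> \<le> B" using continuous_boundary_bounded[OF cont] by blast
  have B0: "0 \<le> B" using B[OF \<zeta>] by linarith
  have GB: "\<bar>?G l\<bar> \<le> B" for l using B B0 by (auto simp: indicator_def)
  obtain k where k: "1 \<le> k" "\<phi> ` cyl (\<zeta> k) \<subseteq> ball (\<phi> \<zeta>) (e / 2)"
    using continuous_boundary_cyl[OF cont \<zeta>, of "ball (\<phi> \<zeta>) (e / 2)"] e by auto
  let ?v = "\<zeta> k"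
  have v: "?v \<in> V" "?v \<noteq> r" using boundary_gpath(1)[OF \<zeta>] bd_neq_root[OF \<zeta> k(1)] by auto
  \<comment> \<open>\<open>2 * B\<close> bounds the difference when the limit misses the cylinder,
    including the root, where the integrand is 0.\<close>
  have bound: "\<bar>poisson_integral V E \<omega> r \<phi> x - \<phi> \<zeta>\<bar> \<le> e / 2 + 2 * B * (hit x / hit ?v)"
    if x: "x \<in> below ?v" for x
  proof -
    let ?W = "walk_law E r x"
    interpret prob_space ?W by (rule prob_space_walk_law)
    let ?N = "{z. ?wl z \<notin> Inr ` cyl ?v}"
    have N: "?N \<in> events"
      using sets.compl_sets[OF walk_limit_cyl_sets[OF v(1), of x]]
      by (simp add: Collect_neg_eq Compl_eq_Diff_UNIV)
    have Gm: "(\<lambda>z. ?G (?wl z)) \<in> borel_measurable ?W"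
      by (rule measurable_compose[OF measurable_walk_limit poisson_integrand_measurable[OF cont]])
    have Gi: "integrable ?W (\<lambda>z. ?G (?wl z))"
      using Gm GB by (intro integrable_const_bound[of _ B]) auto
    have "poisson_integral V E \<omega> r \<phi> x = (\<integral>z. ?G (?wl z) \<partial>?W)"
      unfolding poisson_integral_def harmonic_measure_def set_lebesgue_integral_def real_scaleR_def
      by (rule integral_distr[OF measurable_walk_limit poisson_integrand_measurable[OF cont]])
    then have "poisson_integral V E \<omega> r \<phi> x - \<phi> \<zeta> = (\<integral>z. ?G (?wl z) - \<phi> \<zeta> \<partial>?W)"
      using Gi prob_space by simp
    also have "\<bar>\<dots>\<bar> \<le> (\<integral>z. \<bar>?G (?wl z) - \<phi> \<zeta>\<bar> \<partial>?W)" by (rule integral_abs_bound)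
    also have "\<dots> \<le> (\<integral>z. e / 2 + 2 * B * indicator ?N z \<partial>?W)"
    proof (rule integral_mono)
      show "integrable ?W (\<lambda>z. \<bar>?G (?wl z) - \<phi> \<zeta>\<bar>)" using Gi by auto
      show "integrable ?W (\<lambda>z. e / 2 + 2 * B * indicator ?N z)"
        using N by (intro Bochner_Integration.integrable_add integrable_mult_right)
          (auto simp: emeasure_eq_measure)
      fix z
      show "\<bar>?G (?wl z) - \<phi> \<zeta>\<bar> \<le> e / 2 + 2 * B * indicator ?N z"
      proof (cases "z \<in> ?N")
        case True
        then show ?thesis using GB[of "?wl z"] B[OF \<zeta>] e by simp
      next
        case False
        then obtain \<xi> where \<xi>: "?wl z = Inr \<xi>" "\<xi> \<in> cyl ?v" by auto
        then have "\<phi> \<xi> \<in> ball (\<phi> \<zeta>) (e / 2)" "\<xi> \<in> bd" using k(2) by (auto simp: cyl_def)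
        then show ?thesis using \<xi> False by (simp add: dist_real_def abs_minus_commute)
      qed
    qed
    also have "\<dots> = e / 2 + 2 * B * prob ?N"
      using N by (subst Bochner_Integration.integral_add) (use prob_space in \<open>auto simp: emeasure_eq_measure\<close>)
    also have "\<dots> \<le> e / 2 + 2 * B * (hit x / hit ?v)"
      using exit_probability[OF v x] B0 by (intro add_left_mono mult_left_mono) auto
    finally show ?thesis .
  qed
  have "(\<lambda>j. 2 * B * (hit (\<zeta> j) / hit ?v)) \<longlonglongrightarrow> 2 * B * (0 / hit ?v)"
    using hit_pos[of ?v] by (intro tendsto_intros h0) auto
  then have "\<forall>\<^sub>F j in sequentially. 2 * B * (hit (\<zeta> j) / hit ?v) < e / 2"
    using e by (intro order_tendstoD(2)) auto
  then have "\<forall>\<^sub>F j in sequentially. norm (poisson_integral V E \<omega> r \<phi> (\<zeta> j) - \<phi> \<zeta>) < e"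
    using eventually_ge_at_top[of k]
  proof eventually_elim
    case (elim j)
    have "\<zeta> j \<in> below ?v"
      using below_antimono[OF \<zeta>, of k "j - k"] below_self[OF boundary_gpath(1)[OF \<zeta>, of j]] elim by auto
    from bound[OF this] show ?case using elim by simp
  qed
  then show "\<exists>no. \<forall>j\<ge>no. norm (poisson_integral V E \<omega> r \<phi> (\<zeta> j) - \<phi> \<zeta>) < e"
    by (simp add: eventually_sequentially)
qed

text \<open>\<open>hit\<close> decreases along \<zeta>, so it has a limit, which is a lower bound
  and is positive unless it is 0.\<close>

lemma irregular_hit_bounded_below:
  assumes \<zeta>: "\<zeta> \<in> bd" and nc: "\<not> (\<lambda>j. hit (\<zeta> j)) \<longlonglongrightarrow> 0"
  shows "\<exists>l>0. \<forall>j. l \<le> hit (\<zeta> j)"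
proof -
  have "decseq (\<lambda>j. hit (\<zeta> j))" using hit_child_le[OF bd_ch[OF \<zeta>]] by (rule decseq_SucI)
  then obtain l where l: "(\<lambda>j. hit (\<zeta> j)) \<longlonglongrightarrow> l" "\<forall>j. l \<le> hit (\<zeta> j)"
    using decseq_convergent[of "\<lambda>j. hit (\<zeta> j)" 0] hit_pos by (metis less_imp_le)
  have "0 \<le> l" using hit_pos by (intro LIMSEQ_le_const[OF l(1)]) (auto simp: less_imp_le)
  moreover have "l \<noteq> 0" using l nc by auto
  ultimately show ?thesis using l by (intro exI[of _ l]) auto
qed

end

theorem corollary3p6:
  fixes V :: "'v set" and E :: "'v set set" and \<omega> :: "'v set" and r :: 'v
  assumes "rooted_tree V E \<omega> r"
  shows "capacity E {\<zeta> \<in> tree_boundary E \<omega> r.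
           \<exists>\<phi>. continuous_map (boundary_topology E \<omega> r) euclideanreal \<phi> \<and>
             \<not> ((\<lambda>j. poisson_integral V E \<omega> r \<phi> (\<zeta> j)) \<longlonglongrightarrow> \<phi> \<zeta>)} = 0"
proof -
  interpret rooted_tree V E \<omega> r by fact
  \<comment> \<open>By contraposition of \<open>poisson_integral_tendsto\<close>, \<open>hit\<close>
    does not tend to 0 along an irregular point.\<close>
  show ?thesis
    by (rule capacity_eq_0) (use poisson_integral_tendsto irregular_hit_bounded_below in blast)
qed

end
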